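(* Let $R$ be a ring, $M$ a nonzero uniformly finite $R$-module, $N$ a submodule of $M$ with $N\neq M$, and $\pi:M\to M/N$, $m\mapsto m+N$. The maximal shortest primary decompositions of $N$ in $M$ are precisely the decompositions $N=C_1\cap\cdots\cap C_s$ obtained as follows: take nonzero submodules $W_1,\ldots,W_s$ of $M/N$ whose sum is direct, such that $W_1\oplus\cdots\oplus W_s$ is an essential submodule of $M/N$ and the sets $\operatorname{As}_R(W_1)=\{X_1\},\ldots,\operatorname{As}_R(W_s)=\{X_s\}$ are singletons that are pairwise distinct; for each $i=1,\ldots,s$ take a complement $\overline{C}_i$ to $W_i$ in $M/N$ that contains the modules $W_j$, $j\neq i$; and set $C_i:=\pi^{-1}(\overline{C}_i)$.
   Context: Rings have $1$ and need not be commutative; module means left module. A submodule $N$ of $M$ is essential if $N\cap L\neq 0$ for every nonzero submodule $L$ of $M$. A module $U$ is uniform if $U\neq 0$ and every nonzero submodule of $U$ is essential in $U$. A module has finite uniform dimension if it contains no infinite direct sum of nonzero submodules; then $\operatorname{u.dim}(M)$ is the number of summands in any essential direct sum of uniform submodules of $M$ ($0$ if $M=0$). Modules $M_1,M_2$ are essentially equivalent if there are essential submodules $L_1\subseteq M_1$, $L_2\subseteq M_2$ with $L_1\simeq L_2$; $[M]$ denotes the equivalence class of $M$. For a module $M$ of finite uniform dimension, $\operatorname{As}_R(M)=\{[U] : U \text{ is a uniform submodule of } M\}$. An $R$-module $M$ is uniformly finite if every factor module of $M$ has finite uniform dimension. A submodule $N$ of $M$ is primary if $\operatorname{u.dim}(M/N)<\infty$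 and $\operatorname{As}_R(M/N)$ consists of a single element. A primary decomposition of $N$ in $M$ is an expression $N=N_1\cap\cdots\cap N_s$ ($s\ge 1$ finite) with each $N_i$ a primary submodule of $M$. It is shortest if there is no primary decomposition of $N$ in $M$ with fewer terms. A shortest primary decomposition $N=N_1\cap\cdots\cap N_s$ is maximal if, whenever $N=N_1'\cap\cdots\cap N_s'$ is a shortest primary decomposition with $\operatorname{As}_R(M/N_i')=\operatorname{As}_R(M/N_i)$ and $N_i\subseteq N_i'$ for all $i$, then $N_i=N_i'$ for all $i$. A complement to a submodule $A$ in a module $Q$ is a submodule $C$ of $Q$ that is maximal with respect to the property $A\cap C=0$. *)

theory Defs
  imports "HOL-Algebra.Module" "HOL-Algebra.AbelCoset"
begin

text \<open>The library locale \<open>module\<close> requires a commutative ring of scalars; this is the same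
  locale over an arbitrary ring with unit. The record type \<open>module\<close> and the locale
  \<open>submodule\<close> do not depend on commutativity and are reused. A submodule \<open>U\<close> of \<open>M\<close> is
  regarded as a module in its own right through \<open>M\<lparr>carrier := U\<rparr>\<close>.\<close>

locale left_module = R?: ring R + M?: abelian_group M
  for R :: "('r, 'x) ring_scheme" (structure) and M :: "('r, 'b, 'y) module_scheme" (structure) +
  assumes smult_closed [simp, intro]:
      "\<lbrakk>a \<in> carrier R; x \<in> carrier M\<rbrakk> \<Longrightarrow> a \<odot>\<^bsub>M\<^esub> x \<in> carrier M"
    and smult_l_distr:
      "\<lbrakk>a \<in> carrier R; b \<in> carrier R; x \<in> carrier M\<rbrakk> \<Longrightarrow>
        (a \<oplus>\<^bsub>R\<^esub> b) \<odot>\<^bsub>M\<^esub> x = a \<odot>\<^bsub>M\<^esub> x \<oplus>\<^bsub>M\<^esub> b \<odot>\<^bsub>M\<^esub> x"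
    and smult_r_distr:
      "\<lbrakk>a \<in> carrier R; x \<in> carrier M; y \<in> carrier M\<rbrakk> \<Longrightarrow>
        a \<odot>\<^bsub>M\<^esub> (x \<oplus>\<^bsub>M\<^esub> y) = a \<odot>\<^bsub>M\<^esub> x \<oplus>\<^bsub>M\<^esub> a \<odot>\<^bsub>M\<^esub> y"
    and smult_assoc1:
      "\<lbrakk>a \<in> carrier R; b \<in> carrier R; x \<in> carrier M\<rbrakk> \<Longrightarrow>
        (a \<otimes>\<^bsub>R\<^esub> b) \<odot>\<^bsub>M\<^esub> x = a \<odot>\<^bsub>M\<^esub> (b \<odot>\<^bsub>M\<^esub> x)"
    and smult_one [simp]: "x \<in> carrier M \<Longrightarrow> \<one>\<^bsub>R\<^esub> \<odot>\<^bsub>M\<^esub> x = x"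

text \<open>The record type \<open>module\<close> inherits the fields \<open>mult\<close> and \<open>one\<close> from rings; they play no
  role for modules. The scalar action is \<open>r (x + N) = r x + N\<close>, written without a choice of
  representative.\<close>

definition quot_module ::
    "('r, 'b, 'y) module_scheme \<Rightarrow> 'b set \<Rightarrow> ('r, 'b set) module" where
  "quot_module M N =
    \<lparr>carrier = a_rcosets\<^bsub>M\<^esub> N, mult = undefined, one = undefined,
     zero = N, add = set_add M,
     smult = (\<lambda>r X. \<Union>x\<in>X. N +>\<^bsub>M\<^esub> (r \<odot>\<^bsub>M\<^esub> x))\<rparr>"

definition module_isomorphic ::
    "('r, 'x) ring_scheme \<Rightarrow> ('r, 'b, 'y) module_scheme \<Rightarrow> ('r, 'c, 'z) module_scheme \<Rightarrow> bool" where
  "module_isomorphic R A B \<longleftrightarrow>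
    (\<exists>f \<in> iso (add_monoid A) (add_monoid B).
      \<forall>r\<in>carrier R. \<forall>x\<in>carrier A. f (r \<odot>\<^bsub>A\<^esub> x) = r \<odot>\<^bsub>B\<^esub> f x)"

definition essential_submodule ::
    "('r, 'x) ring_scheme \<Rightarrow> ('r, 'b, 'y) module_scheme \<Rightarrow> 'b set \<Rightarrow> bool" where
  "essential_submodule R M N \<longleftrightarrow>
    submodule N R M \<and>
    (\<forall>L. submodule L R M \<and> L \<noteq> {\<zero>\<^bsub>M\<^esub>} \<longrightarrow> N \<inter> L \<noteq> {\<zero>\<^bsub>M\<^esub>})"

definition uniform_module ::
    "('r, 'x) ring_scheme \<Rightarrow> ('r, 'b, 'y) module_scheme \<Rightarrow> bool" where
  "uniform_module R U \<longleftrightarrow>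
    carrier U \<noteq> {\<zero>\<^bsub>U\<^esub>} \<and>
    (\<forall>L. submodule L R U \<and> L \<noteq> {\<zero>\<^bsub>U\<^esub>} \<longrightarrow> essential_submodule R U L)"

definition direct_family ::
    "('r, 'b, 'y) module_scheme \<Rightarrow> 'i set \<Rightarrow> ('i \<Rightarrow> 'b set) \<Rightarrow> bool" where
  "direct_family M I L \<longleftrightarrow>
    (\<forall>J x. J \<subseteq> I \<and> finite J \<and> x \<in> (\<Pi> j\<in>J. L j) \<and> finsum M x J = \<zero>\<^bsub>M\<^esub> \<longrightarrow>
      (\<forall>j\<in>J. x j = \<zero>\<^bsub>M\<^esub>))"

text \<open>Only meant for finite \<open>I\<close>.\<close>

definition submodule_sum ::
    "('r, 'b, 'y) module_scheme \<Rightarrow> 'i set \<Rightarrow> ('i \<Rightarrow> 'b set) \<Rightarrow> 'b set" where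
  "submodule_sum M I L = {finsum M x I | x. x \<in> (\<Pi> i\<in>I. L i)}"

text \<open>The members of a direct family of nonzero submodules are pairwise different, so such a
  family may be indexed by the set of its members.\<close>

definition finite_uniform_dim ::
    "('r, 'x) ring_scheme \<Rightarrow> ('r, 'b, 'y) module_scheme \<Rightarrow> bool" where
  "finite_uniform_dim R M \<longleftrightarrow>
    \<not> (\<exists>\<L>. infinite \<L> \<and> (\<forall>L\<in>\<L>. submodule L R M \<and> L \<noteq> {\<zero>\<^bsub>M\<^esub>}) \<and>
         direct_family M \<L> (\<lambda>L. L))"

definition uniformly_finite ::
    "('r, 'x) ring_scheme \<Rightarrow> ('r, 'b, 'y) module_scheme \<Rightarrow> bool" where
  "uniformly_finite R M \<longleftrightarrow>
    (\<forall>K. submodule K R M \<longrightarrow> finite_uniform_dim R (quot_module M K))"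

definition essentially_equivalent ::
    "('r, 'x) ring_scheme \<Rightarrow> ('r, 'b, 'y) module_scheme \<Rightarrow> ('r, 'c, 'z) module_scheme \<Rightarrow> bool" where
  "essentially_equivalent R A B \<longleftrightarrow>
    (\<exists>L K. essential_submodule R A L \<and> essential_submodule R B K \<and>
       module_isomorphic R (A\<lparr>carrier := L\<rparr>) (B\<lparr>carrier := K\<rparr>))"

text \<open>The class \<open>[M]\<close>, formed among the modules whose elements have the same type as those of
  \<open>M\<close>. Since \<open>M\<close> is itself one of these, two such classes coincide iff the modules are
  essentially equivalent.\<close>

definition ess_class ::
    "('r, 'x) ring_scheme \<Rightarrow> ('r, 'b, 'y) module_scheme \<Rightarrow> ('r, 'b) module set" where
  "ess_class R M = {V. left_module R V \<and> essentially_equivalent R M V}"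

definition As ::
    "('r, 'x) ring_scheme \<Rightarrow> ('r, 'b, 'y) module_scheme \<Rightarrow> ('r, 'b) module set set" where
  "As R M =
    {ess_class R (M\<lparr>carrier := U\<rparr>) | U. submodule U R M \<and> uniform_module R (M\<lparr>carrier := U\<rparr>)}"

definition primary_submodule ::
    "('r, 'x) ring_scheme \<Rightarrow> ('r, 'b, 'y) module_scheme \<Rightarrow> 'b set \<Rightarrow> bool" where
  "primary_submodule R M N \<longleftrightarrow>
    submodule N R M \<and> finite_uniform_dim R (quot_module M N) \<and>
    (\<exists>X. As R (quot_module M N) = {X})"

text \<open>A decomposition with \<open>s\<close> terms is a family indexed by \<open>{1..s}\<close>; the values of the
  function outside this interval are irrelevant.\<close>

definition primary_decomposition ::
    "('r, 'x) ring_scheme \<Rightarrow> ('r, 'b, 'y) module_scheme \<Rightarrow> 'b set \<Rightarrow> nat \<Rightarrow> (nat \<Rightarrow> 'b set) \<Rightarrow> bool" where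
  "primary_decomposition R M N s C \<longleftrightarrow>
    1 \<le> s \<and> (\<forall>i\<in>{1..s}. primary_submodule R M (C i)) \<and> N = (\<Inter>i\<in>{1..s}. C i)"

definition shortest_primary_decomposition ::
    "('r, 'x) ring_scheme \<Rightarrow> ('r, 'b, 'y) module_scheme \<Rightarrow> 'b set \<Rightarrow> nat \<Rightarrow> (nat \<Rightarrow> 'b set) \<Rightarrow> bool" where
  "shortest_primary_decomposition R M N s C \<longleftrightarrow>
    primary_decomposition R M N s C \<and>
    \<not> (\<exists>t D. t < s \<and> primary_decomposition R M N t D)"

definition maximal_shortest_primary_decomposition ::
    "('r, 'x) ring_scheme \<Rightarrow> ('r, 'b, 'y) module_scheme \<Rightarrow> 'b set \<Rightarrow> nat \<Rightarrow> (nat \<Rightarrow> 'b set) \<Rightarrow> bool" where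
  "maximal_shortest_primary_decomposition R M N s C \<longleftrightarrow>
    shortest_primary_decomposition R M N s C \<and>
    (\<forall>C'. shortest_primary_decomposition R M N s C' \<and>
       (\<forall>i\<in>{1..s}. As R (quot_module M (C' i)) = As R (quot_module M (C i)) \<and> C i \<subseteq> C' i) \<longrightarrow>
       (\<forall>i\<in>{1..s}. C i = C' i))"

definition complement_to ::
    "('r, 'x) ring_scheme \<Rightarrow> ('r, 'b, 'y) module_scheme \<Rightarrow> 'b set \<Rightarrow> 'b set \<Rightarrow> bool" where
  "complement_to R Q A C \<longleftrightarrow>
    submodule C R Q \<and> A \<inter> C = {\<zero>\<^bsub>Q\<^esub>} \<and>
    (\<forall>D. submodule D R Q \<and> A \<inter> D = {\<zero>\<^bsub>Q\<^esub>} \<and> C \<subseteq> D \<longrightarrow> D = C)"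

end

theory Submission
  imports Defs
begin

text \<open>Put \<open>Q = M/N\<close> and write \<open>C'\<close> for the image in \<open>Q\<close> of a submodule \<open>C \<supseteq> N\<close>. If
  \<open>N = C\<^sub>1 \<inter> \<dots> \<inter> C\<^sub>s\<close>, a uniform submodule \<open>U\<close> of \<open>Q\<close> cannot meet every \<open>C\<^sub>i'\<close> nontrivially, so it
  embeds in some \<open>M/C\<^sub>i\<close>; thus every primary decomposition has at least as many terms as \<open>As Q\<close> has
  elements. Given the \<open>W\<^sub>i\<close>, maximality of the complement makes \<open>W\<^sub>i\<close> embed in \<open>M/C\<^sub>i\<close> with essential
  image, so that \<open>As (M/C\<^sub>i) = As W\<^sub>i\<close>; the \<open>C\<^sub>i'\<close> intersect in \<open>0\<close> because their intersection misses
  the essential submodule \<open>\<Sum> W\<^sub>i\<close>, and a larger \<open>C\<^sub>i'\<close> would contain a uniform submodule of \<open>W\<^sub>i\<close>,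
  which by its class \<open>X\<^sub>i\<close> embeds in no other \<open>M/C\<^sub>j\<close> and so would meet every component. Conversely, in a shortest decomposition components of
  equal class could be merged, so the classes are distinct, and \<open>W\<^sub>i = \<Inter>\<^bsub>j \<noteq> i\<^esub> C\<^sub>j'\<close> is nonzero since no
  component can be dropped. These \<open>W\<^sub>i\<close> are independent with essential sum, \<open>C\<^sub>i'\<close> extends to a
  complement of \<open>W\<^sub>i\<close>, and maximality forces \<open>C\<^sub>i'\<close> to be that complement.\<close>

section \<open>Submodules\<close>

lemma submodule_subset: "submodule H R M \<Longrightarrow> H \<subseteq> carrier M"
  using subgroup.subset[OF submodule.axioms(1), of H R M] by simp

lemma submodule_zero: "submodule H R M \<Longrightarrow> \<zero>\<^bsub>M\<^esub> \<in> H"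
  using subgroup.one_closed[OF submodule.axioms(1), of H R M] by simp

lemma submodule_add: "\<lbrakk>submodule H R M; x \<in> H; y \<in> H\<rbrakk> \<Longrightarrow> x \<oplus>\<^bsub>M\<^esub> y \<in> H"
  using subgroup.m_closed[OF submodule.axioms(1), of H R M] by simp

lemma submodule_a_inv: "\<lbrakk>submodule H R M; x \<in> H\<rbrakk> \<Longrightarrow> \<ominus>\<^bsub>M\<^esub> x \<in> H"
  using subgroup.m_inv_closed[OF submodule.axioms(1), of H R M] by (simp add: a_inv_def)

lemma submodule_smult: "\<lbrakk>submodule H R M; r \<in> carrier R; x \<in> H\<rbrakk> \<Longrightarrow> r \<odot>\<^bsub>M\<^esub> x \<in> H"
  by (rule submodule.smult_closed)

lemma submodule_neq_zeroD:
  assumes "submodule H R M" "H \<noteq> {\<zero>\<^bsub>M\<^esub>}"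
  obtains x where "x \<in> H" "x \<noteq> \<zero>\<^bsub>M\<^esub>"
  using assms submodule_zero[OF assms(1)] that by blast

context left_module
begin

lemma smult_zero [simp]:
  assumes "r \<in> carrier R"
  shows "r \<odot>\<^bsub>M\<^esub> \<zero>\<^bsub>M\<^esub> = \<zero>\<^bsub>M\<^esub>"
proof -
  have "r \<odot>\<^bsub>M\<^esub> \<zero>\<^bsub>M\<^esub> \<oplus>\<^bsub>M\<^esub> r \<odot>\<^bsub>M\<^esub> \<zero>\<^bsub>M\<^esub> = r \<odot>\<^bsub>M\<^esub> \<zero>\<^bsub>M\<^esub>"
    using assms by (simp flip: smult_r_distr)
  then show ?thesis using assms by simp
qed

lemma zero_smult [simp]:
  assumes "x \<in> carrier M"
  shows "\<zero>\<^bsub>R\<^esub> \<odot>\<^bsub>M\<^esub> x = \<zero>\<^bsub>M\<^esub>"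
proof -
  have "\<zero>\<^bsub>R\<^esub> \<odot>\<^bsub>M\<^esub> x \<oplus>\<^bsub>M\<^esub> \<zero>\<^bsub>R\<^esub> \<odot>\<^bsub>M\<^esub> x = \<zero>\<^bsub>R\<^esub> \<odot>\<^bsub>M\<^esub> x"
    using assms by (simp flip: smult_l_distr)
  then show ?thesis using assms by simp
qed

lemma smult_minus_one:
  assumes "x \<in> carrier M"
  shows "(\<ominus>\<^bsub>R\<^esub> \<one>\<^bsub>R\<^esub>) \<odot>\<^bsub>M\<^esub> x = \<ominus>\<^bsub>M\<^esub> x"
proof -
  have "(\<ominus>\<^bsub>R\<^esub> \<one>\<^bsub>R\<^esub>) \<odot>\<^bsub>M\<^esub> x \<oplus>\<^bsub>M\<^esub> \<one>\<^bsub>R\<^esub> \<odot>\<^bsub>M\<^esub> x = \<zero>\<^bsub>M\<^esub>"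
    using assms by (simp add: R.l_neg del: smult_one flip: smult_l_distr)
  then show ?thesis using assms by (simp add: M.minus_equality)
qed

text \<open>Closure under additive inverses comes from closure under scalars, since -x =
  (-1)x.\<close>

lemma submoduleI:
  assumes "H \<subseteq> carrier M" "\<zero>\<^bsub>M\<^esub> \<in> H"
    and "\<And>a b. \<lbrakk>a \<in> H; b \<in> H\<rbrakk> \<Longrightarrow> a \<oplus>\<^bsub>M\<^esub> b \<in> H"
    and s: "\<And>a x. \<lbrakk>a \<in> carrier R; x \<in> H\<rbrakk> \<Longrightarrow> a \<odot>\<^bsub>M\<^esub> x \<in> H"
  shows "submodule H R M"
proof -
  have "\<ominus>\<^bsub>M\<^esub> x \<in> H" if "x \<in> H" for x
    using s[of "\<ominus>\<^bsub>R\<^esub> \<one>\<^bsub>R\<^esub>" x] that assms(1) smult_minus_one by auto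
  with assms show ?thesis
    by (intro submodule.intro subgroup.intro)
      (auto simp: submodule_axioms_def simp flip: a_inv_def)
qed

lemma submodule_carrier: "submodule (carrier M) R M"
  by (rule submoduleI) auto

lemma submodule_Int: "\<lbrakk>submodule H R M; submodule K R M\<rbrakk> \<Longrightarrow> submodule (H \<inter> K) R M"
  by (rule submoduleI)
    (auto dest: submodule_subset submodule_zero intro: submodule_add submodule_smult)

text \<open>The intersection is cut down to \<open>carrier M\<close> so that an empty
  \<open>I\<close> yields the whole module rather than \<open>UNIV\<close>. This case occurs for
  decompositions with a single term.\<close>

lemma submodule_INT:
  assumes "\<And>i. i \<in> I \<Longrightarrow> submodule (D i) R M"
  shows "submodule (carrier M \<inter> (\<Inter>i\<in>I. D i)) R M"
  using assms
  by (intro submoduleI) (auto dest: submodule_zero intro: submodule_add submodule_smult)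

lemma left_module_restrict:
  assumes "submodule H R M"
  shows "left_module R (M\<lparr>carrier := H\<rparr>)"
proof -
  note sub = submodule_subset[OF assms]
  have "abelian_group (M\<lparr>carrier := H\<rparr>)"
  proof (rule abelian_groupI)
    show "\<exists>y\<in>carrier (M\<lparr>carrier := H\<rparr>). y \<oplus>\<^bsub>M\<lparr>carrier := H\<rparr>\<^esub> x = \<zero>\<^bsub>M\<lparr>carrier := H\<rparr>\<^esub>"
      if "x \<in> carrier (M\<lparr>carrier := H\<rparr>)" for x
      using that sub submodule_a_inv[OF assms] M.l_neg by auto
  qed (use sub in \<open>auto intro: submodule_add[OF assms] submodule_zero[OF assms] M.a_assoc M.a_comm\<close>)
  then show ?thesis
    using sub R.ring_axioms
    by (intro left_module.intro left_module_axioms.intro)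
      (simp_all add: subset_iff smult_l_distr smult_r_distr smult_assoc1 submodule_smult[OF assms])
qed

text \<open>Restricting the carrier keeps the operations and the zero of \<open>M\<close>. Notions
  for the restricted module can therefore be unfolded into statements about submodules of
  \<open>M\<close> alone; uniformity and \<open>As\<close> are treated this way.\<close>

lemma submodule_restrict_iff:
  assumes "submodule H R M"
  shows "submodule L R (M\<lparr>carrier := H\<rparr>) \<longleftrightarrow> submodule L R M \<and> L \<subseteq> H"
proof
  assume L: "submodule L R (M\<lparr>carrier := H\<rparr>)"
  note s = submodule_subset[OF L] submodule_zero[OF L] submodule_add[OF L] submodule_smult[OF L]
  then show "submodule L R M \<and> L \<subseteq> H"
    using submodule_subset[OF assms] by (auto intro!: submoduleI)
next
  assume L: "submodule L R M \<and> L \<subseteq> H"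
  interpret H: left_module R "M\<lparr>carrier := H\<rparr>" by (rule left_module_restrict[OF assms])
  show "submodule L R (M\<lparr>carrier := H\<rparr>)"
    using L by (intro H.submoduleI) (auto dest: submodule_zero intro: submodule_add submodule_smult)
qed

section \<open>Finite sums of submodules, and complements\<close>

lemma finsum_submodule:
  assumes "submodule H R M" "\<And>i. i \<in> I \<Longrightarrow> x i \<in> H"
  shows "finsum M x I \<in> H"
  using assms(2)
proof (induction I rule: infinite_finite_induct)
  case (insert i I)
  then have "x \<in> insert i I \<rightarrow> carrier M" using submodule_subset[OF assms(1)] by auto
  with insert show ?case by (auto simp: M.finsum_insert intro: submodule_add[OF assms(1)])
qed (auto simp: submodule_zero[OF assms(1)])

lemma finsum_remove:
  assumes "finite I" "i \<in> I" "x \<in> I \<rightarrow> carrier M"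
  shows "finsum M x I = x i \<oplus>\<^bsub>M\<^esub> finsum M x (I - {i})"
proof -
  have "finsum M x (insert i (I - {i})) = x i \<oplus>\<^bsub>M\<^esub> finsum M x (I - {i})"
    using assms by (intro M.finsum_insert) auto
  then show ?thesis using assms(2) by (simp add: insert_absorb)
qed

lemma smult_finsum:
  assumes "r \<in> carrier R" "x \<in> I \<rightarrow> carrier M"
  shows "r \<odot>\<^bsub>M\<^esub> finsum M x I = finsum M (\<lambda>i. r \<odot>\<^bsub>M\<^esub> x i) I"
  using assms(2)
proof (induction I rule: infinite_finite_induct)
  case (insert i I)
  then have "finsum M x I \<in> carrier M" by auto
  moreover have "(\<lambda>i. r \<odot>\<^bsub>M\<^esub> x i) \<in> insert i I \<rightarrow> carrier M" using insert assms(1) by auto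
  ultimately show ?case using insert assms(1) by (auto simp: M.finsum_insert smult_r_distr)
qed (use assms(1) in auto)

lemma submodule_submodule_sum:
  assumes "\<And>i. i \<in> I \<Longrightarrow> submodule (W i) R M"
  shows "submodule (submodule_sum M I W) R M"
proof (rule submoduleI)
  have W: "x \<in> I \<rightarrow> carrier M" if "x \<in> Pi I W" for x
    using that submodule_subset[OF assms] by (auto simp: Pi_iff)
  show "submodule_sum M I W \<subseteq> carrier M" using W by (auto simp: submodule_sum_def)
  have "(\<lambda>i. \<zero>\<^bsub>M\<^esub>) \<in> Pi I W" using submodule_zero[OF assms] by auto
  then show "\<zero>\<^bsub>M\<^esub> \<in> submodule_sum M I W"
    unfolding submodule_sum_def by (intro CollectI exI[of _ "\<lambda>i. \<zero>\<^bsub>M\<^esub>"]) simp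
  show "a \<oplus>\<^bsub>M\<^esub> b \<in> submodule_sum M I W"
    if ab: "a \<in> submodule_sum M I W" "b \<in> submodule_sum M I W" for a b
  proof -
    obtain x y where x: "x \<in> Pi I W" "a = finsum M x I" and y: "y \<in> Pi I W" "b = finsum M y I"
      using ab by (auto simp: submodule_sum_def)
    have "(\<lambda>i. x i \<oplus>\<^bsub>M\<^esub> y i) \<in> Pi I W" using x y by (auto intro: submodule_add[OF assms])
    moreover have "a \<oplus>\<^bsub>M\<^esub> b = finsum M (\<lambda>i. x i \<oplus>\<^bsub>M\<^esub> y i) I"
      using x y W by (simp add: M.finsum_addf)
    ultimately show ?thesis unfolding submodule_sum_def by blast
  qed
  show "r \<odot>\<^bsub>M\<^esub> a \<in> submodule_sum M I W"
    if r: "r \<in> carrier R" and a: "a \<in> submodule_sum M I W" for r a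
  proof -
    obtain x where x: "x \<in> Pi I W" "a = finsum M x I" using a by (auto simp: submodule_sum_def)
    have "(\<lambda>i. r \<odot>\<^bsub>M\<^esub> x i) \<in> Pi I W" using x r by (auto intro: submodule_smult[OF assms])
    then show ?thesis unfolding submodule_sum_def using x(2) smult_finsum[OF r W[OF x(1)]] by blast
  qed
qed

lemma submodule_sum_upper:
  assumes "finite I" "i \<in> I" "\<And>i. i \<in> I \<Longrightarrow> submodule (W i) R M"
  shows "W i \<subseteq> submodule_sum M I W"
proof
  fix w assume w: "w \<in> W i"
  let ?x = "\<lambda>j. if j = i then w else \<zero>\<^bsub>M\<^esub>"
  have wc: "w \<in> carrier M" using w submodule_subset[OF assms(3)[OF assms(2)]] by auto
  have "?x \<in> Pi I W" using w submodule_zero[OF assms(3)] by auto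
  moreover have "finsum M ?x I = w"
    using M.finsum_singleton[of i I "\<lambda>_. w"] assms wc by (simp add: eq_commute cong: if_cong)
  ultimately show "w \<in> submodule_sum M I W" unfolding submodule_sum_def by (intro CollectI exI[of _ ?x]) simp
qed

text \<open>Zorn's lemma, applied to the submodules that contain \<open>B\<close> and meet
  \<open>A\<close> trivially; the union of a nonempty chain of them is again one. Starting from a
  given \<open>B\<close> is what later allows a component of a decomposition to be enlarged to a
  complement.\<close>

lemma complement_exists:
  assumes A: "submodule A R M" and B: "submodule B R M" and AB: "A \<inter> B = {\<zero>\<^bsub>M\<^esub>}"
  obtains C where "B \<subseteq> C" "complement_to R M A C"
proof -
  define \<A> where "\<A> = {D. submodule D R M \<and> A \<inter> D = {\<zero>\<^bsub>M\<^esub>} \<and> B \<subseteq> D}"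
  have "\<exists>C\<in>\<A>. \<forall>X\<in>\<A>. C \<subseteq> X \<longrightarrow> X = C"
  proof (rule subset_Zorn_nonempty)
    show "\<A> \<noteq> {}" using assms by (auto simp: \<A>_def)
    fix \<C> assume ne: "\<C> \<noteq> {}" and ch: "subset.chain \<A> \<C>"
    have mem: "submodule D R M" "A \<inter> D = {\<zero>\<^bsub>M\<^esub>}" "B \<subseteq> D" if "D \<in> \<C>" for D
      using ch that by (auto simp: \<A>_def subset.chain_def)
    have "submodule (\<Union>\<C>) R M"
    proof (rule submoduleI)
      show "\<Union>\<C> \<subseteq> carrier M" using submodule_subset[OF mem(1)] by blast
      show "\<zero>\<^bsub>M\<^esub> \<in> \<Union>\<C>" using ne submodule_zero[OF mem(1)] by blast
      show "a \<odot>\<^bsub>M\<^esub> x \<in> \<Union>\<C>" if "a \<in> carrier R" "x \<in> \<Union>\<C>" for a x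
        using that submodule_smult[OF mem(1)] by blast
      show "a \<oplus>\<^bsub>M\<^esub> b \<in> \<Union>\<C>" if ab: "a \<in> \<Union>\<C>" "b \<in> \<Union>\<C>" for a b
      proof -
        obtain D E where "D \<in> \<C>" "E \<in> \<C>" "a \<in> D" "b \<in> E" using ab by auto
        moreover have "D \<subseteq> E \<or> E \<subseteq> D" using ch calculation by (auto simp: subset.chain_def)
        ultimately show ?thesis using submodule_add[OF mem(1)] by blast
      qed
    qed
    moreover have "A \<inter> \<Union>\<C> = {\<zero>\<^bsub>M\<^esub>}" using ne mem(2) by blast
    moreover have "B \<subseteq> \<Union>\<C>" using ne mem(3) by blast
    ultimately show "\<Union>\<C> \<in> \<A>" by (simp add: \<A>_def)
  qed
  then obtain C where C: "C \<in> \<A>" and max: "\<And>D. D \<in> \<A> \<Longrightarrow> C \<subseteq> D \<Longrightarrow> D = C" by blast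
  have "B \<subseteq> C" using C by (simp add: \<A>_def)
  \<comment> \<open>A submodule above \<open>C\<close> contains \<open>B\<close> as well, so
    maximality within \<open>\<A>\<close> is maximality among all submodules that meet
    \<open>A\<close> trivially.\<close>
  moreover have "D = C" if "submodule D R M" "A \<inter> D = {\<zero>\<^bsub>M\<^esub>}" "C \<subseteq> D" for D
    using that max[of D] \<open>B \<subseteq> C\<close> by (simp add: \<A>_def)
  ultimately show ?thesis
    using C by (intro that[of C]) (auto simp: complement_to_def \<A>_def)
qed

end

section \<open>Uniform modules and essential equivalence\<close>

lemma (in left_module) uniform_restrict_iff:
  assumes U: "submodule U R M"
  shows "uniform_module R (M\<lparr>carrier := U\<rparr>) \<longleftrightarrow> U \<noteq> {\<zero>\<^bsub>M\<^esub>} \<and>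
    (\<forall>L K. submodule L R M \<and> L \<subseteq> U \<and> L \<noteq> {\<zero>\<^bsub>M\<^esub>} \<and> submodule K R M \<and> K \<subseteq> U \<and> K \<noteq> {\<zero>\<^bsub>M\<^esub>} \<longrightarrow>
      L \<inter> K \<noteq> {\<zero>\<^bsub>M\<^esub>})"
  unfolding uniform_module_def essential_submodule_def submodule_restrict_iff[OF U] by auto

lemma (in left_module) uniform_Int:
  assumes "submodule U R M" "uniform_module R (M\<lparr>carrier := U\<rparr>)"
    and "submodule L R M" "L \<subseteq> U" "L \<noteq> {\<zero>\<^bsub>M\<^esub>}" "submodule K R M" "K \<subseteq> U" "K \<noteq> {\<zero>\<^bsub>M\<^esub>}"
  shows "L \<inter> K \<noteq> {\<zero>\<^bsub>M\<^esub>}"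
  using assms uniform_restrict_iff by auto

lemma (in left_module) uniform_nonzero:
  assumes "submodule U R M" "uniform_module R (M\<lparr>carrier := U\<rparr>)"
  shows "U \<noteq> {\<zero>\<^bsub>M\<^esub>}"
  using assms uniform_restrict_iff by auto

lemma (in left_module) uniform_subset:
  assumes "submodule U R M" "uniform_module R (M\<lparr>carrier := U\<rparr>)"
    and "submodule V R M" "V \<subseteq> U" "V \<noteq> {\<zero>\<^bsub>M\<^esub>}"
  shows "uniform_module R (M\<lparr>carrier := V\<rparr>)"
  unfolding uniform_restrict_iff[OF assms(3)]
  using assms(4,5) uniform_Int[OF assms(1,2)] by (meson order_trans)

text \<open>Each partial intersection with \<open>U\<close> is again a nonzero submodule of
  \<open>U\<close>, so uniformity can be applied once more at every step of the induction. For empty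
  \<open>I\<close> the intersection is \<open>U\<close> itself.\<close>

lemma (in left_module) uniform_Int_INT:
  assumes U: "submodule U R M" "uniform_module R (M\<lparr>carrier := U\<rparr>)"
    and "finite I" "\<And>i. i \<in> I \<Longrightarrow> submodule (D i) R M" "\<And>i. i \<in> I \<Longrightarrow> U \<inter> D i \<noteq> {\<zero>\<^bsub>M\<^esub>}"
  shows "U \<inter> (\<Inter>i\<in>I. D i) \<noteq> {\<zero>\<^bsub>M\<^esub>}"
  using assms(3-)
proof (induction I)
  case empty
  then show ?case using uniform_nonzero[OF U] by simp
next
  case (insert i I)
  have "U \<inter> (\<Inter>i\<in>I. D i) = U \<inter> (carrier M \<inter> (\<Inter>i\<in>I. D i))"
    using submodule_subset[OF U(1)] by auto
  then have "submodule (U \<inter> (\<Inter>i\<in>I. D i)) R M"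
    using submodule_Int[OF U(1) submodule_INT[of I D]] insert.prems(1) by simp
  moreover have "U \<inter> (\<Inter>i\<in>I. D i) \<noteq> {\<zero>\<^bsub>M\<^esub>}" using insert by simp
  moreover have "submodule (U \<inter> D i) R M" using submodule_Int[OF U(1)] insert.prems(1) by simp
  ultimately have "(U \<inter> D i) \<inter> (U \<inter> (\<Inter>i\<in>I. D i)) \<noteq> {\<zero>\<^bsub>M\<^esub>}"
    using insert.prems(2)[of i] by - (rule uniform_Int[OF U], auto)
  moreover have "(U \<inter> D i) \<inter> (U \<inter> (\<Inter>i\<in>I. D i)) = U \<inter> (\<Inter>i\<in>insert i I. D i)" by auto
  ultimately show ?case by simp
qed

section \<open>Module homomorphisms and transport along them\<close>

locale left_module_hom = A: left_module R A + B: left_module R B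
  for R :: "('r, 'x) ring_scheme" and A :: "('r, 'a, 'y) module_scheme"
    and B :: "('r, 'b, 'z) module_scheme" +
  fixes f :: "'a \<Rightarrow> 'b"
  assumes hom_closed [simp, intro]: "x \<in> carrier A \<Longrightarrow> f x \<in> carrier B"
    and hom_add: "\<lbrakk>x \<in> carrier A; y \<in> carrier A\<rbrakk> \<Longrightarrow> f (x \<oplus>\<^bsub>A\<^esub> y) = f x \<oplus>\<^bsub>B\<^esub> f y"
    and hom_smult: "\<lbrakk>r \<in> carrier R; x \<in> carrier A\<rbrakk> \<Longrightarrow> f (r \<odot>\<^bsub>A\<^esub> x) = r \<odot>\<^bsub>B\<^esub> f x"
begin

lemma hom_zero [simp]: "f \<zero>\<^bsub>A\<^esub> = \<zero>\<^bsub>B\<^esub>"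
  using hom_smult[of "\<zero>\<^bsub>R\<^esub>" "\<zero>\<^bsub>A\<^esub>"] by simp

lemma hom_minus:
  assumes "x \<in> carrier A"
  shows "f (\<ominus>\<^bsub>A\<^esub> x) = \<ominus>\<^bsub>B\<^esub> f x"
  using hom_smult[of "\<ominus>\<^bsub>R\<^esub> \<one>\<^bsub>R\<^esub>" x] assms by (simp add: A.smult_minus_one B.smult_minus_one)

lemma submodule_image:
  assumes "submodule L R A"
  shows "submodule (f ` L) R B"
proof (rule B.submoduleI)
  note L = submodule_subset[OF assms]
  show "f ` L \<subseteq> carrier B" using L by auto
  show "\<zero>\<^bsub>B\<^esub> \<in> f ` L" using submodule_zero[OF assms] by (metis hom_zero image_eqI)
  show "a \<oplus>\<^bsub>B\<^esub> b \<in> f ` L" if "a \<in> f ` L" "b \<in> f ` L" for a b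
    using that submodule_add[OF assms] L by (force simp: hom_add[symmetric] subset_iff)
  show "r \<odot>\<^bsub>B\<^esub> a \<in> f ` L" if "r \<in> carrier R" "a \<in> f ` L" for r a
    using that submodule_smult[OF assms] L by (force simp: hom_smult[symmetric] subset_iff)
qed

lemma submodule_vimage:
  assumes "submodule L R B"
  shows "submodule {x \<in> carrier A. f x \<in> L} R A"
  by (rule A.submoduleI)
    (auto simp: hom_add hom_smult submodule_zero[OF assms]
      intro: submodule_add[OF assms] submodule_smult[OF assms])

text \<open>Injectivity is considered on a submodule \<open>W\<close> because the map from
  \<open>M/N\<close> to \<open>M/C\<^sub>i\<close> used later generally has a nonzero kernel and is
  injective only where \<open>W\<close> avoids it.\<close>

lemma inj_on_submodule:
  assumes W: "submodule W R A" and "\<And>x. x \<in> W \<Longrightarrow> f x = \<zero>\<^bsub>B\<^esub> \<Longrightarrow> x = \<zero>\<^bsub>A\<^esub>"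
  shows "inj_on f W"
proof (rule inj_onI)
  fix x y assume xy: "x \<in> W" "y \<in> W" "f x = f y"
  then have c: "x \<in> carrier A" "y \<in> carrier A" using submodule_subset[OF W] by auto
  have "x \<oplus>\<^bsub>A\<^esub> \<ominus>\<^bsub>A\<^esub> y \<in> W" using xy by (intro submodule_add[OF W] submodule_a_inv[OF W])
  moreover have "f (x \<oplus>\<^bsub>A\<^esub> \<ominus>\<^bsub>A\<^esub> y) = \<zero>\<^bsub>B\<^esub>"
    using xy c by (simp add: hom_add hom_minus B.r_neg)
  ultimately have "x \<oplus>\<^bsub>A\<^esub> \<ominus>\<^bsub>A\<^esub> y = \<zero>\<^bsub>A\<^esub>" using assms(2) by simp
  then show "x = y" using c by (metis A.a_inv_closed A.minus_equality A.minus_minus)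
qed

lemma inj_on_eq_zero:
  assumes "inj_on f W" "submodule W R A" "x \<in> W" "f x = \<zero>\<^bsub>B\<^esub>"
  shows "x = \<zero>\<^bsub>A\<^esub>"
  using assms submodule_zero[OF assms(2)] by (metis hom_zero inj_onD)

lemma image_neq_zero:
  assumes "inj_on f W" "submodule W R A" "L \<subseteq> W" "submodule L R A" "L \<noteq> {\<zero>\<^bsub>A\<^esub>}"
  shows "f ` L \<noteq> {\<zero>\<^bsub>B\<^esub>}"
proof -
  obtain x where "x \<in> L" "x \<noteq> \<zero>\<^bsub>A\<^esub>" using submodule_neq_zeroD[OF assms(4,5)] .
  then show ?thesis using inj_on_eq_zero[OF assms(1,2)] assms(3) by blast
qed

text \<open>A nonzero \<open>L\<close> in \<open>B\<close> pulls back to a nonzero submodule because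
  \<open>f\<close> is surjective. The pullback meets \<open>E\<close>, and injectivity keeps a
  common nonzero element nonzero under \<open>f\<close>.\<close>

lemma essential_image:
  assumes bij: "bij_betw f (carrier A) (carrier B)" and E: "essential_submodule R A E"
  shows "essential_submodule R B (f ` E)"
  unfolding essential_submodule_def
proof (intro conjI allI impI)
  have inj: "inj_on f (carrier A)" using bij by (simp add: bij_betw_def)
  have sE: "submodule E R A" using E by (simp add: essential_submodule_def)
  then show "submodule (f ` E) R B" by (rule submodule_image)
  fix L assume L: "submodule L R B \<and> L \<noteq> {\<zero>\<^bsub>B\<^esub>}"
  then obtain y where y: "y \<in> L" "y \<noteq> \<zero>\<^bsub>B\<^esub>" by (auto elim: submodule_neq_zeroD)
  then have "y \<in> f ` carrier A" using L bij submodule_subset[of L R B] by (auto simp: bij_betw_def)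
  then obtain x where x: "x \<in> carrier A" "f x = y" by auto
  let ?L = "{x \<in> carrier A. f x \<in> L}"
  have sL: "submodule ?L R A" using L by (simp add: submodule_vimage)
  moreover have "x \<in> ?L" "x \<noteq> \<zero>\<^bsub>A\<^esub>" using x y by auto
  then have "?L \<noteq> {\<zero>\<^bsub>A\<^esub>}" by blast
  ultimately have "E \<inter> ?L \<noteq> {\<zero>\<^bsub>A\<^esub>}" using E by (simp add: essential_submodule_def)
  then obtain z where z: "z \<in> E \<inter> ?L" "z \<noteq> \<zero>\<^bsub>A\<^esub>"
    using submodule_neq_zeroD[OF A.submodule_Int[OF sE sL]] by blast
  then have "f z \<noteq> \<zero>\<^bsub>B\<^esub>" using inj_on_eq_zero[OF inj A.submodule_carrier] by auto
  then show "f ` E \<inter> L \<noteq> {\<zero>\<^bsub>B\<^esub>}" using z by blast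
qed

lemma isomorphic_image:
  assumes "inj_on f U" "submodule U R A"
  shows "module_isomorphic R (A\<lparr>carrier := U\<rparr>) (B\<lparr>carrier := f ` U\<rparr>)"
  unfolding module_isomorphic_def iso_def hom_def
  using assms submodule_subset[OF assms(2)]
  by (intro bexI[of _ f]) (auto simp: bij_betw_def hom_smult subset_iff hom_add)

end

section \<open>Isomorphism and essential equivalence as equivalence relations\<close>

lemma module_isomorphicE:
  assumes "module_isomorphic R A B" "left_module R A" "left_module R B"
  obtains f where "left_module_hom R A B f" "bij_betw f (carrier A) (carrier B)"
proof -
  obtain f where f: "f \<in> iso (add_monoid A) (add_monoid B)"
    "\<forall>r\<in>carrier R. \<forall>x\<in>carrier A. f (r \<odot>\<^bsub>A\<^esub> x) = r \<odot>\<^bsub>B\<^esub> f x"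
    using assms(1) by (auto simp: module_isomorphic_def)
  have "left_module_hom R A B f"
    using assms f unfolding left_module_hom_def left_module_hom_axioms_def
    by (auto simp: iso_def hom_def)
  moreover have "bij_betw f (carrier A) (carrier B)" using f(1) by (simp add: iso_def)
  ultimately show ?thesis by (rule that)
qed

lemma (in left_module_hom) isomorphic:
  assumes "bij_betw f (carrier A) (carrier B)"
  shows "module_isomorphic R A B"
  unfolding module_isomorphic_def iso_def hom_def
  using assms by (intro bexI[of _ f]) (auto simp: hom_smult hom_add)

lemma (in left_module_hom) left_module_hom_inv:
  assumes "bij_betw f (carrier A) (carrier B)"
  shows "left_module_hom R B A (inv_into (carrier A) f)"
proof -
  let ?g = "inv_into (carrier A) f"
  have gc: "?g y \<in> carrier A" "f (?g y) = y" if "y \<in> carrier B" for y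
    using assms that by (auto simp: bij_betw_def inv_into_into f_inv_into_f)
  have eq: "?g y = x" if "x \<in> carrier A" "f x = y" for x y
    using assms that by (auto simp: bij_betw_def)
  show ?thesis
  proof unfold_locales
    show "?g (x \<oplus>\<^bsub>B\<^esub> y) = ?g x \<oplus>\<^bsub>A\<^esub> ?g y" if "x \<in> carrier B" "y \<in> carrier B" for x y
      using that gc by (intro eq) (auto simp: hom_add)
    show "?g (r \<odot>\<^bsub>B\<^esub> x) = r \<odot>\<^bsub>A\<^esub> ?g x" if "r \<in> carrier R" "x \<in> carrier B" for r x
      using that gc by (intro eq) (auto simp: hom_smult)
  qed (use gc in auto)
qed

lemma module_isomorphic_sym:
  assumes "module_isomorphic R A B" "left_module R A" "left_module R B"
  shows "module_isomorphic R B A"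
proof -
  obtain f where "left_module_hom R A B f" and bij: "bij_betw f (carrier A) (carrier B)"
    using module_isomorphicE[OF assms] .
  then interpret left_module_hom R A B f by simp
  interpret inv: left_module_hom R B A "inv_into (carrier A) f" by (rule left_module_hom_inv[OF bij])
  show ?thesis by (rule inv.isomorphic[OF bij_betw_inv_into[OF bij]])
qed

lemma module_isomorphic_trans:
  assumes "module_isomorphic R A B" "module_isomorphic R B V"
    "left_module R A" "left_module R B" "left_module R V"
  shows "module_isomorphic R A V"
proof -
  obtain f where f: "left_module_hom R A B f" "bij_betw f (carrier A) (carrier B)"
    using module_isomorphicE[OF assms(1,3,4)] .
  obtain g where g: "left_module_hom R B V g" "bij_betw g (carrier B) (carrier V)"
    using module_isomorphicE[OF assms(2,4,5)] .
  interpret f: left_module_hom R A B f by (rule f)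
  interpret g: left_module_hom R B V g by (rule g)
  interpret gf: left_module_hom R A V "g \<circ> f"
    by unfold_locales (auto simp: f.hom_add g.hom_add f.hom_smult g.hom_smult)
  show ?thesis by (rule gf.isomorphic[OF bij_betw_trans[OF f(2) g(2)]])
qed

lemma essentially_equivalent_sym:
  assumes "essentially_equivalent R A B" "left_module R A" "left_module R B"
  shows "essentially_equivalent R B A"
proof -
  obtain L K where "essential_submodule R A L" "essential_submodule R B K"
    "module_isomorphic R (A\<lparr>carrier := L\<rparr>) (B\<lparr>carrier := K\<rparr>)"
    using assms(1) by (auto simp: essentially_equivalent_def)
  moreover from this have "module_isomorphic R (B\<lparr>carrier := K\<rparr>) (A\<lparr>carrier := L\<rparr>)"
    using left_module.left_module_restrict[OF assms(2)] left_module.left_module_restrict[OF assms(3)]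
    by (metis essential_submodule_def module_isomorphic_sym)
  ultimately show ?thesis by (auto simp: essentially_equivalent_def)
qed

lemma (in left_module) essential_Int_restrict:
  assumes "essential_submodule R M K" "essential_submodule R M K'"
  shows "essential_submodule R (M\<lparr>carrier := K\<rparr>) (K \<inter> K')"
  using assms unfolding essential_submodule_def
  by (auto simp: submodule_restrict_iff submodule_Int Int_absorb1 Int_assoc inf_absorb2)
 
lemma (in left_module) essential_trans:
  assumes K: "essential_submodule R M K" and E: "essential_submodule R (M\<lparr>carrier := K\<rparr>) E"
  shows "essential_submodule R M E"
  unfolding essential_submodule_def
proof (intro conjI allI impI)
  have sK: "submodule K R M" using K by (simp add: essential_submodule_def)
  have sE: "submodule E R M" "E \<subseteq> K"
    using E by (auto simp: essential_submodule_def submodule_restrict_iff[OF sK])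
  show "submodule E R M" by fact
  fix L assume L: "submodule L R M \<and> L \<noteq> {\<zero>\<^bsub>M\<^esub>}"
  then have "K \<inter> L \<noteq> {\<zero>\<^bsub>M\<^esub>}" "submodule (K \<inter> L) R M"
    using K by (auto simp: essential_submodule_def submodule_Int)
  then have "E \<inter> (K \<inter> L) \<noteq> {\<zero>\<^bsub>M\<^esub>}"
    using E by (simp add: essential_submodule_def submodule_restrict_iff[OF sK])
  moreover have "E \<inter> (K \<inter> L) = E \<inter> L" using sE by auto
  ultimately show "E \<inter> L \<noteq> {\<zero>\<^bsub>M\<^esub>}" by simp
qed

text \<open>The two equivalences single out essential submodules \<open>K\<close> and
  \<open>K'\<close> of the middle module. Their intersection is essential in both, so its images
  under the two isomorphisms are essential in \<open>A\<close> and in \<open>V\<close>, and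
  isomorphic to each other through it.\<close>

lemma essentially_equivalent_trans:
  assumes AB: "essentially_equivalent R A B" and BV: "essentially_equivalent R B V"
    and "left_module R A" "left_module R B" "left_module R V"
  shows "essentially_equivalent R A V"
proof -
  interpret A: left_module R A by fact
  interpret B: left_module R B by fact
  interpret V: left_module R V by fact
  \<comment> \<open>Reversing the first equivalence makes both isomorphisms start in
    \<open>B\<close>, so that both can be restricted to \<open>D\<close>.\<close>
  have "essentially_equivalent R B A" by (rule essentially_equivalent_sym) fact+
  then obtain K L where K: "essential_submodule R B K" and L: "essential_submodule R A L"
    and KL: "module_isomorphic R (B\<lparr>carrier := K\<rparr>) (A\<lparr>carrier := L\<rparr>)"
    by (auto simp: essentially_equivalent_def)
  obtain K' P where K': "essential_submodule R B K'" and P: "essential_submodule R V P"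
    and KP: "module_isomorphic R (B\<lparr>carrier := K'\<rparr>) (V\<lparr>carrier := P\<rparr>)"
    using BV by (auto simp: essentially_equivalent_def)
  have sub: "submodule K R B" "submodule L R A" "submodule K' R B" "submodule P R V"
    using K L K' P by (auto simp: essential_submodule_def)
  note rest = B.left_module_restrict[OF sub(1)] A.left_module_restrict[OF sub(2)]
    B.left_module_restrict[OF sub(3)] V.left_module_restrict[OF sub(4)]
  obtain f where f: "left_module_hom R (B\<lparr>carrier := K\<rparr>) (A\<lparr>carrier := L\<rparr>) f" "bij_betw f K L"
    using module_isomorphicE[OF KL rest(1,2)] by auto
  obtain g where g: "left_module_hom R (B\<lparr>carrier := K'\<rparr>) (V\<lparr>carrier := P\<rparr>) g" "bij_betw g K' P"
    using module_isomorphicE[OF KP rest(3,4)] by auto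
  interpret f: left_module_hom R "B\<lparr>carrier := K\<rparr>" "A\<lparr>carrier := L\<rparr>" f by (rule f)
  interpret g: left_module_hom R "B\<lparr>carrier := K'\<rparr>" "V\<lparr>carrier := P\<rparr>" g by (rule g)
  define D where "D = K \<inter> K'"
  have D: "submodule D R (B\<lparr>carrier := K\<rparr>)" "submodule D R (B\<lparr>carrier := K'\<rparr>)"
    using sub by (auto simp: D_def B.submodule_restrict_iff B.submodule_Int)
  have fD: "essential_submodule R A (f ` D)"
    using f.essential_image[OF _ B.essential_Int_restrict[OF K K']] f(2)
    by (intro A.essential_trans[OF L]) (simp add: D_def)
  have gD: "essential_submodule R V (g ` D)"
    using g.essential_image[OF _ B.essential_Int_restrict[OF K' K]] g(2)
    by (intro V.essential_trans[OF P]) (simp add: D_def Int_commute)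
  have "module_isomorphic R (B\<lparr>carrier := D\<rparr>) (A\<lparr>carrier := f ` D\<rparr>)"
    using f.isomorphic_image[OF _ D(1)] f(2) by (auto simp: D_def bij_betw_def inj_on_Int)
  moreover have "module_isomorphic R (B\<lparr>carrier := D\<rparr>) (V\<lparr>carrier := g ` D\<rparr>)"
    using g.isomorphic_image[OF _ D(2)] g(2) by (auto simp: D_def bij_betw_def inj_on_Int)
  moreover have "left_module R (B\<lparr>carrier := D\<rparr>)" "left_module R (A\<lparr>carrier := f ` D\<rparr>)"
      "left_module R (V\<lparr>carrier := g ` D\<rparr>)"
    using fD gD sub by (auto simp: D_def essential_submodule_def intro!: B.left_module_restrict
        A.left_module_restrict V.left_module_restrict B.submodule_Int)
  ultimately have "module_isomorphic R (A\<lparr>carrier := f ` D\<rparr>) (V\<lparr>carrier := g ` D\<rparr>)"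
    using module_isomorphic_sym module_isomorphic_trans by blast
  with fD gD show ?thesis by (auto simp: essentially_equivalent_def)
qed

lemma ess_class_eqI:
  assumes "essentially_equivalent R A B" "left_module R A" "left_module R B"
  shows "ess_class R A = ess_class R B"
  unfolding ess_class_def
  using essentially_equivalent_trans[OF assms(1) _ assms(2,3)]
    essentially_equivalent_trans[OF essentially_equivalent_sym[OF assms] _ assms(3,2)] by blast

lemma (in left_module) essential_carrier: "essential_submodule R M (carrier M)"
  unfolding essential_submodule_def
  using submodule_subset[of _ R M] submodule_carrier by (metis Int_absorb1)

section \<open>Associated classes of uniform submodules\<close>

lemma (in left_module) As_restrict:
  assumes "submodule W R M"
  shows "As R (M\<lparr>carrier := W\<rparr>) = {ess_class R (M\<lparr>carrier := U\<rparr>) | U.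
    submodule U R M \<and> U \<subseteq> W \<and> uniform_module R (M\<lparr>carrier := U\<rparr>)}"
  by (simp add: As_def submodule_restrict_iff[OF assms] conj_assoc)

lemma (in left_module) As_mono:
  assumes "submodule W R M"
  shows "As R (M\<lparr>carrier := W\<rparr>) \<subseteq> As R M"
  unfolding As_restrict[OF assms] by (auto simp: As_def)

text \<open>\<open>V\<close> is essential in the uniform module \<open>U\<close>, and the identity
  of \<open>V\<close> serves as the isomorphism. A uniform submodule may thus be shrunk without
  changing its class.\<close>

lemma (in left_module) ess_class_uniform_subset:
  assumes U: "submodule U R M" "uniform_module R (M\<lparr>carrier := U\<rparr>)"
    and V: "submodule V R M" "V \<subseteq> U" "V \<noteq> {\<zero>\<^bsub>M\<^esub>}"
  shows "ess_class R (M\<lparr>carrier := V\<rparr>) = ess_class R (M\<lparr>carrier := U\<rparr>)"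
proof (rule ess_class_eqI)
  show V': "left_module R (M\<lparr>carrier := V\<rparr>)" by (rule left_module_restrict[OF V(1)])
  show "left_module R (M\<lparr>carrier := U\<rparr>)" by (rule left_module_restrict[OF U(1)])
  have "module_isomorphic R (M\<lparr>carrier := V\<rparr>) (M\<lparr>carrier := V\<rparr>)"
    unfolding module_isomorphic_def by (intro bexI[of _ id]) (auto simp: iso_def hom_def)
  moreover have "essential_submodule R (M\<lparr>carrier := V\<rparr>) V"
    using V by (auto simp: essential_submodule_def submodule_restrict_iff Int_absorb1)
  moreover have "essential_submodule R (M\<lparr>carrier := U\<rparr>) V"
    using U V by (simp add: uniform_module_def submodule_restrict_iff)
  ultimately show "essentially_equivalent R (M\<lparr>carrier := V\<rparr>) (M\<lparr>carrier := U\<rparr>)"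
    unfolding essentially_equivalent_def by (intro exI[of _ V]) simp
qed

context left_module_hom
begin

text \<open>Every submodule of the image of \<open>U\<close> is the image of its preimage in
  \<open>U\<close>, which is nonzero when the submodule is. Two such preimages meet nontrivially in
  \<open>U\<close>, and injectivity carries their intersection over.\<close>

lemma uniform_image:
  assumes inj: "inj_on f U" and U: "submodule U R A" "uniform_module R (A\<lparr>carrier := U\<rparr>)"
  shows "uniform_module R (B\<lparr>carrier := f ` U\<rparr>)"
  unfolding B.uniform_restrict_iff[OF submodule_image[OF U(1)]]
proof (intro conjI allI impI)
  show "f ` U \<noteq> {\<zero>\<^bsub>B\<^esub>}"
    using image_neq_zero[OF inj U(1) subset_refl U(1) A.uniform_nonzero[OF U]] .
  have pre: "\<exists>L'. submodule L' R A \<and> L' \<subseteq> U \<and> L' \<noteq> {\<zero>\<^bsub>A\<^esub>} \<and> f ` L' = L"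
    if L: "submodule L R B" "L \<subseteq> f ` U" "L \<noteq> {\<zero>\<^bsub>B\<^esub>}" for L
  proof (intro exI conjI)
    let ?L = "U \<inter> {x \<in> carrier A. f x \<in> L}"
    show "submodule ?L R A" by (rule A.submodule_Int[OF U(1) submodule_vimage[OF L(1)]])
    show im: "f ` ?L = L" using L(2) submodule_subset[OF U(1)] by auto
    show "?L \<noteq> {\<zero>\<^bsub>A\<^esub>}"
    proof
      assume "?L = {\<zero>\<^bsub>A\<^esub>}"
      then have "f ` ?L = {\<zero>\<^bsub>B\<^esub>}" by simp
      with im L(3) show False by simp
    qed
  qed auto
  fix L K
  assume LK: "submodule L R B \<and> L \<subseteq> f ` U \<and> L \<noteq> {\<zero>\<^bsub>B\<^esub>} \<and>
    submodule K R B \<and> K \<subseteq> f ` U \<and> K \<noteq> {\<zero>\<^bsub>B\<^esub>}"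
  obtain L' where L': "submodule L' R A" "L' \<subseteq> U" "L' \<noteq> {\<zero>\<^bsub>A\<^esub>}" "f ` L' = L"
    using pre[of L] LK by blast
  obtain K' where K': "submodule K' R A" "K' \<subseteq> U" "K' \<noteq> {\<zero>\<^bsub>A\<^esub>}" "f ` K' = K"
    using pre[of K] LK by blast
  have "f ` (L' \<inter> K') \<noteq> {\<zero>\<^bsub>B\<^esub>}"
    using A.uniform_Int[OF U L'(1-3) K'(1-3)] L' K' A.submodule_Int
    by (intro image_neq_zero[OF inj U(1)]) auto
  moreover have "f ` (L' \<inter> K') = L \<inter> K"
    using inj_on_image_Int[OF inj L'(2) K'(2)] L' K' by simp
  ultimately show "L \<inter> K \<noteq> {\<zero>\<^bsub>B\<^esub>}" by simp
qed

end

text \<open>Stated outside the homomorphism locale because the classes of \<open>A\<close> and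
  \<open>B\<close> are comparable only when both modules have the same element type, whereas the
  locale leaves the two types independent.\<close>

lemma ess_class_image:
  fixes A :: "('r, 'a, 'y) module_scheme" and B :: "('r, 'a, 'z) module_scheme"
  assumes "left_module_hom R A B f" and inj: "inj_on f U" and U: "submodule U R A"
  shows "ess_class R (B\<lparr>carrier := f ` U\<rparr>) = ess_class R (A\<lparr>carrier := U\<rparr>)"
proof -
  interpret left_module_hom R A B f by fact
  have l: "left_module R (A\<lparr>carrier := U\<rparr>)" by (rule A.left_module_restrict[OF U])
  have r: "left_module R (B\<lparr>carrier := f ` U\<rparr>)"
    by (rule B.left_module_restrict[OF submodule_image[OF U]])
  have "essentially_equivalent R (A\<lparr>carrier := U\<rparr>) (B\<lparr>carrier := f ` U\<rparr>)"
    using isomorphic_image[OF inj U] left_module.essential_carrier[OF l] left_module.essential_carrier[OF r]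
    by (auto simp: essentially_equivalent_def)
  from ess_class_eqI[OF this l r] show ?thesis by simp
qed

lemma As_hom_mono:
  fixes A :: "('r, 'a, 'y) module_scheme" and B :: "('r, 'a, 'z) module_scheme"
  assumes hom: "left_module_hom R A B f" and inj: "inj_on f W" and W: "submodule W R A"
  shows "As R (A\<lparr>carrier := W\<rparr>) \<subseteq> As R B"
proof -
  interpret left_module_hom R A B f by fact
  show ?thesis
  proof
    fix X assume "X \<in> As R (A\<lparr>carrier := W\<rparr>)"
    then obtain U where U: "submodule U R A" "U \<subseteq> W" "uniform_module R (A\<lparr>carrier := U\<rparr>)"
      and X: "X = ess_class R (A\<lparr>carrier := U\<rparr>)" by (auto simp: A.As_restrict[OF W])
    have injU: "inj_on f U" using inj U(2) by (rule inj_on_subset)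
    show "X \<in> As R B"
      using ess_class_image[OF hom injU U(1)] uniform_image[OF injU U(1,3)] submodule_image[OF U(1)] X
      by (auto simp: As_def)
  qed
qed

text \<open>Beyond \<open>As_hom_mono\<close> one inclusion remains. A uniform \<open>U\<close> in
  \<open>B\<close> meets the essential image of \<open>W\<close> in a nonzero \<open>V\<close>,
  which has the class of \<open>U\<close>; since \<open>f\<close> is injective on \<open>W\<close>,
  an isomorphic copy of \<open>V\<close> lies inside \<open>W\<close>.\<close>

lemma As_hom_eq:
  fixes A :: "('r, 'a, 'y) module_scheme" and B :: "('r, 'a, 'z) module_scheme"
  assumes hom: "left_module_hom R A B f" and inj: "inj_on f W" and W: "submodule W R A"
    and ess: "essential_submodule R B (f ` W)"
  shows "As R B = As R (A\<lparr>carrier := W\<rparr>)"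
proof
  interpret left_module_hom R A B f by fact
  show "As R B \<subseteq> As R (A\<lparr>carrier := W\<rparr>)"
  proof
    fix X assume "X \<in> As R B"
    then obtain U where U: "submodule U R B" "uniform_module R (B\<lparr>carrier := U\<rparr>)"
      and X: "X = ess_class R (B\<lparr>carrier := U\<rparr>)" by (auto simp: As_def)
    define V where "V = f ` W \<inter> U"
    have V: "submodule V R B" "V \<subseteq> U" "V \<noteq> {\<zero>\<^bsub>B\<^esub>}"
      using ess U B.uniform_nonzero[OF U] submodule_image[OF W] B.submodule_Int
      by (auto simp: V_def essential_submodule_def)
    have XV: "X = ess_class R (B\<lparr>carrier := V\<rparr>)"
      using B.ess_class_uniform_subset[OF U V] X by simp
    define V' where "V' = W \<inter> {x \<in> carrier A. f x \<in> V}"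
    have V': "submodule V' R A"
      unfolding V'_def by (rule A.submodule_Int[OF W submodule_vimage[OF V(1)]])
    have im: "f ` V' = V" using submodule_subset[OF W] by (auto simp: V'_def V_def)
    have injV': "inj_on f V'" using inj by (rule inj_on_subset) (auto simp: V'_def)
    \<comment> \<open>The isomorphism is inverted because \<open>uniform_image\<close> moves
      uniformity forwards, and here it has to travel from \<open>V\<close> back to
      \<open>V'\<close>.\<close>
    have iso: "module_isomorphic R (B\<lparr>carrier := V\<rparr>) (A\<lparr>carrier := V'\<rparr>)"
      using isomorphic_image[OF injV' V'] im
      by (intro module_isomorphic_sym[OF _ A.left_module_restrict[OF V'] B.left_module_restrict[OF V(1)]])
        simp
    obtain g where "left_module_hom R (B\<lparr>carrier := V\<rparr>) (A\<lparr>carrier := V'\<rparr>) g" "bij_betw g V V'"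
      using module_isomorphicE[OF iso] A.left_module_restrict[OF V'] B.left_module_restrict[OF V(1)]
      by auto
    then interpret g: left_module_hom R "B\<lparr>carrier := V\<rparr>" "A\<lparr>carrier := V'\<rparr>" g by simp
    have "uniform_module R (B\<lparr>carrier := V\<rparr>)" by (rule B.uniform_subset[OF U V])
    then have "uniform_module R (A\<lparr>carrier := V'\<rparr>)"
      using g.uniform_image[of V] \<open>bij_betw g V V'\<close> g.A.submodule_carrier by (simp add: bij_betw_def)
    then show "X \<in> As R (A\<lparr>carrier := W\<rparr>)"
      using ess_class_image[OF hom injV' V'] im V' XV by (auto simp: A.As_restrict[OF W] V'_def)
  qed
  show "As R (A\<lparr>carrier := W\<rparr>) \<subseteq> As R B" by (rule As_hom_mono[OF hom inj W])
qed

section \<open>Existence of uniform submodules\<close>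

lemma (in left_module) submodule_add_eq_zero:
  assumes "submodule H R M" "a \<in> carrier M" "b \<in> H" "a \<oplus>\<^bsub>M\<^esub> b = \<zero>\<^bsub>M\<^esub>"
  shows "a \<in> H"
proof -
  have "b \<in> carrier M" using assms(1,3) submodule_subset by blast
  then have "a = \<ominus>\<^bsub>M\<^esub> b" using assms(2,4) by (simp add: M.minus_equality)
  then show ?thesis using submodule_a_inv[OF assms(1,3)] by simp
qed

text \<open>Without uniform submodules one could split \<open>L \<supseteq> A\<^sub>0 \<oplus> S\<^sub>1\<close>, \<open>S\<^sub>1 \<supseteq> A\<^sub>1 \<oplus> S\<^sub>2\<close>, and so on
  forever, making the \<open>A\<^sub>n\<close> an infinite direct family.\<close>

lemma (in left_module) exists_uniform:
  assumes fin: "finite_uniform_dim R M" and L: "submodule L R M" "L \<noteq> {\<zero>\<^bsub>M\<^esub>}"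
  obtains U where "submodule U R M" "U \<subseteq> L" "uniform_module R (M\<lparr>carrier := U\<rparr>)"
proof -
  define P where "P B \<longleftrightarrow> submodule B R M \<and> B \<noteq> {\<zero>\<^bsub>M\<^esub>} \<and> B \<subseteq> L" for B
  have False if no: "\<not> (\<exists>U. submodule U R M \<and> U \<subseteq> L \<and> uniform_module R (M\<lparr>carrier := U\<rparr>))"
  proof -
    \<comment> \<open>A nonzero submodule \<open>B\<close> of \<open>L\<close> is not uniform, so it
      contains two nonzero submodules with zero intersection. The implication makes the choice total
      in \<open>B\<close>: where \<open>P\<close> fails, any pair will do.\<close>
    have "\<exists>p. P B \<longrightarrow> P (fst p) \<and> P (snd p) \<and> fst p \<subseteq> B \<and> snd p \<subseteq> B \<and> fst p \<inter> snd p = {\<zero>\<^bsub>M\<^esub>}" for B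
    proof (cases "P B")
      case True
      then have B: "submodule B R M" "B \<noteq> {\<zero>\<^bsub>M\<^esub>}" "B \<subseteq> L" by (auto simp: P_def)
      then have "\<not> uniform_module R (M\<lparr>carrier := B\<rparr>)" using no by blast
      then obtain L' K where "submodule L' R M" "L' \<subseteq> B" "L' \<noteq> {\<zero>\<^bsub>M\<^esub>}"
        "submodule K R M" "K \<subseteq> B" "K \<noteq> {\<zero>\<^bsub>M\<^esub>}" "L' \<inter> K = {\<zero>\<^bsub>M\<^esub>}"
        using B(2) unfolding uniform_restrict_iff[OF B(1)] by blast
      then show ?thesis using B(3) by (intro exI[of _ "(L', K)"]) (auto simp: P_def)
    qed simp
    then have "\<forall>B. \<exists>p. P B \<longrightarrow> P (fst p) \<and> P (snd p) \<and> fst p \<subseteq> B \<and> snd p \<subseteq> B \<and> fst p \<inter> snd p = {\<zero>\<^bsub>M\<^esub>}"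
      by blast
    from choice[OF this] obtain p where p: "\<forall>B. P B \<longrightarrow> P (fst (p B)) \<and> P (snd (p B)) \<and>
      fst (p B) \<subseteq> B \<and> snd (p B) \<subseteq> B \<and> fst (p B) \<inter> snd (p B) = {\<zero>\<^bsub>M\<^esub>}"
      ..
    define a where "a B = fst (p B)" for B
    define b where "b B = snd (p B)" for B
    have ab: "P (a B) \<and> P (b B) \<and> a B \<subseteq> B \<and> b B \<subseteq> B \<and> a B \<inter> b B = {\<zero>\<^bsub>M\<^esub>}" if "P B" for B
      using p that by (simp add: a_def b_def)
    \<comment> \<open>The second half is split again at every step: \<open>S n\<close> is what
      remains after \<open>n\<close> splittings, and \<open>A n\<close> is the part set aside from
      it.\<close>
    define S where "S n = (b ^^ n) L" for n
    define A where "A n = a (S n)" for n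
    have S: "P (S n)" for n
      using L ab by (induction n) (auto simp: S_def P_def)
    have A: "P (A n)" "A n \<subseteq> S n" "A n \<inter> S (Suc n) = {\<zero>\<^bsub>M\<^esub>}" "S (Suc n) \<subseteq> S n" for n
      using ab[OF S[of n]] by (auto simp: A_def S_def)
    have anti: "S m \<subseteq> S n" if "n \<le> m" for m n
      using lift_Suc_antimono_le[of S, OF A(4) that] .
    \<comment> \<open>All later parts lie in \<open>S (Suc n)\<close>, which meets
      \<open>A n\<close> only in zero. Distinctness and independence of the \<open>A n\<close> both
      rest on this.\<close>
    have later: "A m \<subseteq> S (Suc n)" if "n < m" for m n
      using A(2)[of m] anti[of "Suc n" m] that by auto
    \<comment> \<open>The family is indexed by the set of its members, so it is infinite only once
      its members are known to be pairwise different.\<close>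
    have "A n \<noteq> A m" if "n < m" for m n
    proof
      assume "A n = A m"
      then have "A n \<inter> S (Suc n) = A n" using later[OF that] by (simp add: Int_absorb2)
      then show False using A(1)[of n] A(3)[of n] by (simp add: P_def)
    qed
    then have inj: "inj A" by (rule linorder_injI)
    have "direct_family M (range A) (\<lambda>L. L)"
      unfolding direct_family_def
    proof (intro allI impI)
      fix J x assume "J \<subseteq> range A \<and> finite J \<and> x \<in> (\<Pi> j\<in>J. j) \<and> finsum M x J = \<zero>\<^bsub>M\<^esub>"
      then have J: "J \<subseteq> range A" "finite J" and x: "x \<in> (\<Pi> j\<in>J. j)"
        and sum: "finsum M x J = \<zero>\<^bsub>M\<^esub>" by simp_all
      have xc: "x \<in> J \<rightarrow> carrier M"
      proof
        fix j assume "j \<in> J"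
        then obtain i where "j = A i" using J(1) by auto
        then have "j \<subseteq> carrier M" using A(1)[of i] submodule_subset[of j R M] by (simp add: P_def)
        then show "x j \<in> carrier M" using x \<open>j \<in> J\<close> by auto
      qed
      \<comment> \<open>Strong induction on the index: terms of smaller index vanish by hypothesis
        and terms of larger index lie in \<open>S (Suc i)\<close>. So \<open>x (A i)\<close> is the
        negative of an element of \<open>S (Suc i)\<close> and must be zero.\<close>
      have "x (A i) = \<zero>\<^bsub>M\<^esub>" if "A i \<in> J" for i
        using that
      proof (induction i rule: less_induct)
        case (less i)
        have sS: "submodule (S (Suc i)) R M" using S[of "Suc i"] by (simp add: P_def)
        have "finsum M x (J - {A i}) \<in> S (Suc i)"
        proof (rule finsum_submodule[OF sS])
          fix j assume j: "j \<in> J - {A i}"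
          then obtain k where k: "j = A k" "k \<noteq> i" using J(1) by auto
          show "x j \<in> S (Suc i)"
          proof (cases "k < i")
            case True
            then show ?thesis using less.IH[of k] j k submodule_zero[OF sS] by simp
          next
            case False
            then show ?thesis using later[of i k] j k x by auto
          qed
        qed
        moreover have "x (A i) \<oplus>\<^bsub>M\<^esub> finsum M x (J - {A i}) = \<zero>\<^bsub>M\<^esub>"
          using finsum_remove[OF J(2) less.prems xc] sum by simp
        ultimately have "x (A i) \<in> S (Suc i)"
          using submodule_add_eq_zero[OF sS] xc less.prems by blast
        moreover have "x (A i) \<in> A i" using x less.prems by auto
        ultimately show ?case using A(3)[of i] by auto
      qed
      then show "\<forall>j\<in>J. x j = \<zero>\<^bsub>M\<^esub>" using J(1) by auto
    qed
    moreover have "infinite (range A)" using inj finite_imageD[of A UNIV] by auto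
    moreover have "\<forall>L\<in>range A. submodule L R M \<and> L \<noteq> {\<zero>\<^bsub>M\<^esub>}" using A(1) by (auto simp: P_def)
    ultimately show False using fin unfolding finite_uniform_dim_def by blast
  qed
  then show ?thesis using that by blast
qed

lemma (in left_module) As_nonempty:
  assumes "finite_uniform_dim R M" "submodule L R M" "L \<noteq> {\<zero>\<^bsub>M\<^esub>}"
  shows "As R (M\<lparr>carrier := L\<rparr>) \<noteq> {}"
  using exists_uniform[OF assms] by (fastforce simp: As_restrict[OF assms(2)])

section \<open>Factor modules\<close>

locale left_module_quotient = left_module +
  fixes N
  assumes N: "submodule N R M"
begin

abbreviation "Q \<equiv> quot_module M N"

abbreviation proj where "proj x \<equiv> N +>\<^bsub>M\<^esub> x"

lemma N_abelian_subgroup: "abelian_subgroup N M"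
  using submodule.axioms(1)[OF N] M.abelian_group_axioms
  by (intro abelian_subgroupI3 additive_subgroupI)

lemma N_subset: "N \<subseteq> carrier M"
  by (rule submodule_subset[OF N])

lemma quot_carrier: "carrier Q = proj ` carrier M"
  by (auto simp: quot_module_def A_RCOSETS_def')

lemma quot_zero: "\<zero>\<^bsub>Q\<^esub> = N"
  by (simp add: quot_module_def)

lemma proj_eq_iff:
  assumes "x \<in> carrier M" "y \<in> carrier M"
  shows "proj x = proj y \<longleftrightarrow> x \<oplus>\<^bsub>M\<^esub> \<ominus>\<^bsub>M\<^esub> y \<in> N"
proof -
  interpret N: abelian_subgroup N M by (rule N_abelian_subgroup)
  show ?thesis
    using assms N.a_rcos_module[of y x] N.a_rcos_self[of x]
      M.a_repr_independence[OF _ assms(2) N.a_subgroup, of x] by auto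
qed

lemma proj_eq_N_iff:
  assumes "x \<in> carrier M"
  shows "proj x = N \<longleftrightarrow> x \<in> N"
  using M.a_coset_join1 M.a_coset_join2 assms submodule.axioms(1)[OF N] by blast

lemma quot_add: "\<lbrakk>x \<in> carrier M; y \<in> carrier M\<rbrakk> \<Longrightarrow> proj x \<oplus>\<^bsub>Q\<^esub> proj y = proj (x \<oplus>\<^bsub>M\<^esub> y)"
  using abelian_subgroup.a_rcos_sum[OF N_abelian_subgroup] by (simp add: quot_module_def)

text \<open>The union over all representatives in \<open>quot_module\<close> collapses to one coset:
  if \<open>y\<close> and \<open>x\<close> differ by an element of \<open>N\<close>, then so do
  their multiples by \<open>r\<close>.\<close>

lemma quot_smult:
  assumes r: "r \<in> carrier R" and x: "x \<in> carrier M"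
  shows "r \<odot>\<^bsub>Q\<^esub> proj x = proj (r \<odot>\<^bsub>M\<^esub> x)"
proof -
  interpret N: abelian_subgroup N M by (rule N_abelian_subgroup)
  have "proj (r \<odot>\<^bsub>M\<^esub> y) = proj (r \<odot>\<^bsub>M\<^esub> x)" if y: "y \<in> proj x" for y
  proof -
    have yc: "y \<in> carrier M" using y x N.a_elemrcos_carrier by blast
    have "y \<oplus>\<^bsub>M\<^esub> \<ominus>\<^bsub>M\<^esub> x \<in> N" using N.a_rcos_module[OF x yc] y by simp
    then have "r \<odot>\<^bsub>M\<^esub> (y \<oplus>\<^bsub>M\<^esub> \<ominus>\<^bsub>M\<^esub> x) \<in> N" using submodule_smult[OF N r] by simp
    moreover have "r \<odot>\<^bsub>M\<^esub> \<ominus>\<^bsub>M\<^esub> x = \<ominus>\<^bsub>M\<^esub> (r \<odot>\<^bsub>M\<^esub> x)"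
    proof (rule M.minus_equality[symmetric])
      show "r \<odot>\<^bsub>M\<^esub> (\<ominus>\<^bsub>M\<^esub> x) \<oplus>\<^bsub>M\<^esub> r \<odot>\<^bsub>M\<^esub> x = \<zero>\<^bsub>M\<^esub>"
        using r x by (simp add: M.l_neg flip: smult_r_distr)
    qed (use r x in auto)
    ultimately show ?thesis using r x yc by (simp add: proj_eq_iff smult_r_distr)
  qed
  moreover have "x \<in> proj x" using N.a_rcos_self x by simp
  ultimately have "(\<Union>y\<in>proj x. proj (r \<odot>\<^bsub>M\<^esub> y)) = proj (r \<odot>\<^bsub>M\<^esub> x)" by blast
  then show ?thesis by (simp add: quot_module_def)
qed

lemma quot_left_module: "left_module R Q"
proof -
  have "abelian_group Q"
  proof (rule abelian_groupI)
    have z: "\<zero>\<^bsub>Q\<^esub> = proj \<zero>\<^bsub>M\<^esub>" using N_subset by (simp add: quot_zero)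
    show "\<exists>y\<in>carrier Q. y \<oplus>\<^bsub>Q\<^esub> X = \<zero>\<^bsub>Q\<^esub>" if X: "X \<in> carrier Q" for X
    proof -
      obtain x where "X = proj x" "x \<in> carrier M" using X by (auto simp: quot_carrier)
      then have "proj (\<ominus>\<^bsub>M\<^esub> x) \<oplus>\<^bsub>Q\<^esub> X = \<zero>\<^bsub>Q\<^esub>" "proj (\<ominus>\<^bsub>M\<^esub> x) \<in> carrier Q"
        by (simp_all add: quot_add z quot_carrier M.l_neg del: M.a_coset_add_zero)
      then show ?thesis by blast
    qed
    show "\<zero>\<^bsub>Q\<^esub> \<in> carrier Q" unfolding z quot_carrier by simp
    show "\<zero>\<^bsub>Q\<^esub> \<oplus>\<^bsub>Q\<^esub> X = X" if "X \<in> carrier Q" for X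
      using that unfolding z quot_carrier by (auto simp del: M.a_coset_add_zero simp: quot_add)
    show "X \<oplus>\<^bsub>Q\<^esub> Y = Y \<oplus>\<^bsub>Q\<^esub> X" if "X \<in> carrier Q" "Y \<in> carrier Q" for X Y
      using that by (auto simp: quot_carrier quot_add M.a_comm)
  qed (auto simp: quot_carrier quot_add M.a_assoc)
  then show ?thesis
    using R.ring_axioms
    by (intro left_module.intro left_module_axioms.intro)
      (auto simp: quot_carrier quot_add quot_smult smult_l_distr smult_r_distr smult_assoc1)
qed

sublocale Q: left_module R Q
  by (rule quot_left_module)

section \<open>Correspondence between submodules of the quotient and submodules above
  \<open>N\<close>\<close>

lemma submodule_vimage_proj:
  assumes D: "submodule D R Q"
  shows "submodule {m \<in> carrier M. proj m \<in> D} R M" "N \<subseteq> {m \<in> carrier M. proj m \<in> D}"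
proof -
  have N0: "proj m = N" if "m \<in> N" for m using that N_subset proj_eq_N_iff by blast
  have "N \<in> D" using submodule_zero[OF D] by (simp add: quot_zero)
  then show "N \<subseteq> {m \<in> carrier M. proj m \<in> D}" using N0 N_subset by auto
  then show "submodule {m \<in> carrier M. proj m \<in> D} R M"
    using submodule_zero[OF N] N_subset submodule_add[OF D] submodule_smult[OF D]
    by (intro submoduleI) (auto simp flip: quot_add quot_smult)
qed

lemma submodule_proj_image:
  assumes K: "submodule K R M"
  shows "submodule (proj ` K) R Q"
proof (rule Q.submoduleI)
  note Kc = submodule_subset[OF K]
  show "proj ` K \<subseteq> carrier Q" using Kc by (auto simp: quot_carrier)
  have "proj \<zero>\<^bsub>M\<^esub> = \<zero>\<^bsub>Q\<^esub>" using N_subset by (simp add: quot_zero)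
  then show "\<zero>\<^bsub>Q\<^esub> \<in> proj ` K" using submodule_zero[OF K] by (metis imageI)
  show "a \<oplus>\<^bsub>Q\<^esub> b \<in> proj ` K" if "a \<in> proj ` K" "b \<in> proj ` K" for a b
    using that Kc submodule_add[OF K] by (force simp: quot_add subset_iff)
  show "r \<odot>\<^bsub>Q\<^esub> a \<in> proj ` K" if "r \<in> carrier R" "a \<in> proj ` K" for r a
    using that Kc submodule_smult[OF K] by (force simp: quot_smult subset_iff)
qed

text \<open>\<open>N \<subseteq> K\<close> makes \<open>K\<close> a union of cosets of
  \<open>N\<close>, so one representative decides for the whole coset.\<close>

lemma proj_mem_image_iff:
  assumes K: "submodule K R M" "N \<subseteq> K" and m: "m \<in> carrier M"
  shows "proj m \<in> proj ` K \<longleftrightarrow> m \<in> K"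
proof
  assume "proj m \<in> proj ` K"
  then obtain k where k: "k \<in> K" "proj m = proj k" by auto
  then have kc: "k \<in> carrier M" using submodule_subset[OF K(1)] by auto
  then have "m \<oplus>\<^bsub>M\<^esub> \<ominus>\<^bsub>M\<^esub> k \<in> K" using k(2) proj_eq_iff[OF m kc] K(2) by auto
  then have "(m \<oplus>\<^bsub>M\<^esub> \<ominus>\<^bsub>M\<^esub> k) \<oplus>\<^bsub>M\<^esub> k \<in> K" using submodule_add[OF K(1) _ k(1)] by simp
  then show "m \<in> K" using m kc by (simp add: M.a_assoc M.l_neg)
qed auto

lemma vimage_proj_image:
  assumes "submodule K R M" "N \<subseteq> K"
  shows "{m \<in> carrier M. proj m \<in> proj ` K} = K"
  using proj_mem_image_iff[OF assms] submodule_subset[OF assms(1)] by auto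

lemma proj_image_vimage:
  assumes "submodule D R Q"
  shows "proj ` {m \<in> carrier M. proj m \<in> D} = D"
  using submodule_subset[OF assms] by (auto simp: quot_carrier)

section \<open>The canonical map from \<open>M/N\<close> to \<open>M/K\<close>\<close>

lemma set_add_proj:
  assumes K: "submodule K R M" "N \<subseteq> K" and x: "x \<in> carrier M"
  shows "K <+>\<^bsub>M\<^esub> proj x = K +>\<^bsub>M\<^esub> x"
proof
  have Kc: "K \<subseteq> carrier M" by (rule submodule_subset[OF K(1)])
  show "K <+>\<^bsub>M\<^esub> proj x \<subseteq> K +>\<^bsub>M\<^esub> x"
  proof
    fix z assume "z \<in> K <+>\<^bsub>M\<^esub> proj x"
    then obtain k n where kn: "k \<in> K" "n \<in> N" "z = k \<oplus>\<^bsub>M\<^esub> (n \<oplus>\<^bsub>M\<^esub> x)"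
      by (auto simp: set_add_def' a_r_coset_def')
    then have "k \<oplus>\<^bsub>M\<^esub> n \<in> K" using K(2) by (intro submodule_add[OF K(1)]) auto
    moreover have "z = (k \<oplus>\<^bsub>M\<^esub> n) \<oplus>\<^bsub>M\<^esub> x"
      using kn x Kc K(2) N_subset M.a_assoc[of k n x] by (simp add: subset_iff)
    ultimately show "z \<in> K +>\<^bsub>M\<^esub> x" by (auto simp: a_r_coset_def')
  qed
  show "K +>\<^bsub>M\<^esub> x \<subseteq> K <+>\<^bsub>M\<^esub> proj x"
  proof
    fix z assume "z \<in> K +>\<^bsub>M\<^esub> x"
    then obtain k where "k \<in> K" "z = k \<oplus>\<^bsub>M\<^esub> x" by (auto simp: a_r_coset_def')
    moreover have "x \<in> proj x" using abelian_subgroup.a_rcos_self[OF N_abelian_subgroup x] .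
    ultimately show "z \<in> K <+>\<^bsub>M\<^esub> proj x" by (auto simp: set_add_def')
  qed
qed

text \<open>Adding \<open>K\<close> to a coset of \<open>N\<close> absorbs \<open>N\<close>, which
  gives the canonical map without a choice of representatives. Source and target both have elements
  of type \<open>'b set\<close>, so their classes can be compared.\<close>

lemma quot_hom:
  assumes K: "submodule K R M" "N \<subseteq> K"
  shows "left_module_hom R Q (quot_module M K) ((<+>\<^bsub>M\<^esub>) K)"
proof -
  interpret K: left_module_quotient R M K
    using left_module_axioms K(1) by (simp add: left_module_quotient_def left_module_quotient_axioms_def)
  show ?thesis
    by unfold_locales
      (auto simp: quot_carrier K.quot_carrier quot_add quot_smult set_add_proj[OF K]
        K.quot_add K.quot_smult)
qed

lemma quot_hom_eq_zero_iff:
  assumes K: "submodule K R M" "N \<subseteq> K" and X: "X \<in> carrier Q"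
  shows "K <+>\<^bsub>M\<^esub> X = \<zero>\<^bsub>quot_module M K\<^esub> \<longleftrightarrow> X \<in> proj ` K"
proof -
  interpret K: left_module_quotient R M K
    using left_module_axioms K(1) by (simp add: left_module_quotient_def left_module_quotient_axioms_def)
  obtain x where "X = proj x" "x \<in> carrier M" using X by (auto simp: quot_carrier)
  then show ?thesis
    using K.proj_eq_N_iff proj_mem_image_iff[OF K] by (simp add: set_add_proj[OF K] K.quot_zero)
qed

lemma quot_hom_inj_on:
  assumes K: "submodule K R M" "N \<subseteq> K" and W: "submodule W R Q" "W \<inter> proj ` K = {\<zero>\<^bsub>Q\<^esub>}"
  shows "inj_on ((<+>\<^bsub>M\<^esub>) K) W"
proof -
  interpret left_module_hom R Q "quot_module M K" "(<+>\<^bsub>M\<^esub>) K" by (rule quot_hom[OF K])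
  show ?thesis
  proof (rule inj_on_submodule[OF W(1)])
    fix X assume X: "X \<in> W" "K <+>\<^bsub>M\<^esub> X = \<zero>\<^bsub>quot_module M K\<^esub>"
    then have "X \<in> W \<inter> proj ` K"
      using quot_hom_eq_zero_iff[OF K, of X] submodule_subset[OF W(1)] by auto
    with W(2) show "X = \<zero>\<^bsub>Q\<^esub>" by simp
  qed
qed

text \<open>\<open>W\<close> avoids the kernel \<open>K/N\<close> of the canonical map and therefore
  embeds in \<open>M/K\<close>.\<close>

lemma As_subset_quot:
  assumes K: "submodule K R M" "N \<subseteq> K" and W: "submodule W R Q" "W \<inter> proj ` K = {\<zero>\<^bsub>Q\<^esub>}"
  shows "As R (Q\<lparr>carrier := W\<rparr>) \<subseteq> As R (quot_module M K)"
  by (rule As_hom_mono[OF quot_hom[OF K] quot_hom_inj_on[OF K W] W(1)])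

text \<open>Maximality of the complement makes the embedded copy of \<open>W\<close> essential: a
  nonzero submodule of \<open>M/K\<close> pulls back to a submodule of \<open>Q\<close> strictly
  above the image of \<open>K\<close>, and this must meet \<open>W\<close>.\<close>

lemma As_quot_eq:
  assumes K: "submodule K R M" "N \<subseteq> K" and W: "submodule W R Q"
    and compl: "complement_to R Q W (proj ` K)"
  shows "As R (quot_module M K) = As R (Q\<lparr>carrier := W\<rparr>)"
proof (rule As_hom_eq[OF quot_hom[OF K] quot_hom_inj_on[OF K W] W])
  show int: "W \<inter> proj ` K = {\<zero>\<^bsub>Q\<^esub>}" using compl by (simp add: complement_to_def)
  interpret K: left_module_quotient R M K
    using left_module_axioms K(1) by (simp add: left_module_quotient_def left_module_quotient_axioms_def)
  interpret left_module_hom R Q "quot_module M K" "(<+>\<^bsub>M\<^esub>) K" by (rule quot_hom[OF K])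
  let ?f = "(<+>\<^bsub>M\<^esub>) K"
  show "essential_submodule R (quot_module M K) (?f ` W)"
    unfolding essential_submodule_def
  proof (intro conjI allI impI)
    show "submodule (?f ` W) R (quot_module M K)" by (rule submodule_image[OF W])
    fix L assume L: "submodule L R (quot_module M K) \<and> L \<noteq> {\<zero>\<^bsub>quot_module M K\<^esub>}"
    define D where "D = {X \<in> carrier Q. ?f X \<in> L}"
    have D: "submodule D R Q" using L submodule_vimage by (simp add: D_def)
    have KD: "proj ` K \<subseteq> D"
    proof
      fix X assume X: "X \<in> proj ` K"
      then have "X \<in> carrier Q" using submodule_subset[OF submodule_proj_image[OF K(1)]] by auto
      then show "X \<in> D"
        using X L submodule_zero[of L R] quot_hom_eq_zero_iff[OF K, of X] by (auto simp: D_def)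
    qed
    obtain y where y: "y \<in> L" "y \<noteq> \<zero>\<^bsub>quot_module M K\<^esub>"
      using L by (auto elim: submodule_neq_zeroD)
    then have "y \<in> carrier (quot_module M K)" using L submodule_subset by blast
    then obtain m where m: "m \<in> carrier M" "y = K +>\<^bsub>M\<^esub> m" by (auto simp: K.quot_carrier)
    then have "proj m \<in> D" "proj m \<notin> proj ` K"
      using y quot_hom_eq_zero_iff[OF K, of "proj m"]
      by (auto simp: D_def quot_carrier set_add_proj[OF K])
    then have "D \<noteq> proj ` K" by blast
    then have "W \<inter> D \<noteq> {\<zero>\<^bsub>Q\<^esub>}" using compl D KD by (auto simp: complement_to_def)
    then obtain X where X: "X \<in> W \<inter> D" "X \<noteq> \<zero>\<^bsub>Q\<^esub>"
      using submodule_neq_zeroD[OF Q.submodule_Int[OF W D]] by blast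
    then have "?f X \<noteq> \<zero>\<^bsub>quot_module M K\<^esub>"
      using int quot_hom_eq_zero_iff[OF K, of X] submodule_subset[OF W] by blast
    then show "?f ` W \<inter> L \<noteq> {\<zero>\<^bsub>quot_module M K\<^esub>}" using X by (auto simp: D_def)
  qed
qed

end

section \<open>Primary decompositions\<close>

context left_module_quotient
begin

lemma quot_trivial_iff: "carrier Q = {\<zero>\<^bsub>Q\<^esub>} \<longleftrightarrow> N = carrier M"
proof
  assume "carrier Q = {\<zero>\<^bsub>Q\<^esub>}"
  then have "proj m = N" if "m \<in> carrier M" for m
    using that by (auto simp: quot_carrier quot_zero)
  then show "N = carrier M" using N_subset proj_eq_N_iff by blast
next
  assume "N = carrier M"
  then have "proj m = N" if "m \<in> carrier M" for m using that proj_eq_N_iff by simp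
  then show "carrier Q = {\<zero>\<^bsub>Q\<^esub>}" by (auto simp: quot_carrier quot_zero)
qed

lemma As_quot_nonempty_imp:
  assumes "As R Q \<noteq> {}"
  shows "N \<noteq> carrier M"
proof
  assume "N = carrier M"
  obtain U where U: "submodule U R Q" "uniform_module R (Q\<lparr>carrier := U\<rparr>)"
    using assms by (auto simp: As_def)
  have "U \<subseteq> {\<zero>\<^bsub>Q\<^esub>}" using submodule_subset[OF U(1)] quot_trivial_iff \<open>N = carrier M\<close> by simp
  then show False using Q.uniform_nonzero[OF U] submodule_zero[OF U(1)] by blast
qed

lemma primary_decompositionD:
  assumes "primary_decomposition R M N s C" "i \<in> {1..s}"
  shows "submodule (C i) R M" "N \<subseteq> C i" "submodule (proj ` C i) R Q"
proof -
  show "submodule (C i) R M" "N \<subseteq> C i"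
    using assms by (auto simp: primary_decomposition_def primary_submodule_def)
  then show "submodule (proj ` C i) R Q" by (simp add: submodule_proj_image)
qed

text \<open>Images do not commute with intersections in general. Here they do because every
  component contains \<open>N\<close>, so a single representative \<open>m\<close> tests membership
  in all of them at once.\<close>

lemma INT_proj_image:
  assumes "primary_decomposition R M N s C" "X \<in> carrier Q" "\<And>i. i \<in> {1..s} \<Longrightarrow> X \<in> proj ` C i"
  shows "X = \<zero>\<^bsub>Q\<^esub>"
proof -
  obtain m where m: "m \<in> carrier M" "X = proj m" using assms(2) by (auto simp: quot_carrier)
  have "m \<in> C i" if i: "i \<in> {1..s}" for i
    using assms(3)[OF i] proj_mem_image_iff[OF primary_decompositionD(1,2)[OF assms(1) i] m(1)] m(2)
    by simp
  then have "m \<in> N" using assms(1) by (simp add: primary_decomposition_def)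
  then show ?thesis using m proj_eq_N_iff by (simp add: quot_zero)
qed

text \<open>The images of the components intersect in zero, whereas finitely many submodules that
  each meet a uniform module nontrivially also do so jointly.\<close>

lemma uniform_avoids_component:
  assumes dec: "primary_decomposition R M N s C"
    and U: "submodule U R Q" "uniform_module R (Q\<lparr>carrier := U\<rparr>)"
  obtains i where "i \<in> {1..s}" "U \<inter> proj ` C i = {\<zero>\<^bsub>Q\<^esub>}"
proof -
  have "\<exists>i\<in>{1..s}. U \<inter> proj ` C i = {\<zero>\<^bsub>Q\<^esub>}"
  proof (rule ccontr)
    assume "\<not> ?thesis"
    then have "U \<inter> (\<Inter>i\<in>{1..s}. proj ` C i) \<noteq> {\<zero>\<^bsub>Q\<^esub>}"
      using primary_decompositionD(3)[OF dec] by (intro Q.uniform_Int_INT[OF U]) auto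
    moreover have "U \<inter> (\<Inter>i\<in>{1..s}. proj ` C i) \<subseteq> {\<zero>\<^bsub>Q\<^esub>}"
      using INT_proj_image[OF dec] submodule_subset[OF U(1)] by blast
    moreover have "\<zero>\<^bsub>Q\<^esub> \<in> U \<inter> (\<Inter>i\<in>{1..s}. proj ` C i)"
      using submodule_zero[OF U(1)] submodule_zero[OF primary_decompositionD(3)[OF dec]] by blast
    ultimately show False by blast
  qed
  then show ?thesis using that by blast
qed

lemma ess_class_in_component:
  assumes U: "submodule U R Q" "uniform_module R (Q\<lparr>carrier := U\<rparr>)"
    and K: "submodule K R M" "N \<subseteq> K" "U \<inter> proj ` K = {\<zero>\<^bsub>Q\<^esub>}"
  shows "ess_class R (Q\<lparr>carrier := U\<rparr>) \<in> As R (quot_module M K)"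
proof -
  have "ess_class R (Q\<lparr>carrier := U\<rparr>) \<in> As R (Q\<lparr>carrier := U\<rparr>)"
    unfolding Q.As_restrict[OF U(1)] using U by blast
  then show ?thesis using As_subset_quot[OF K(1,2) U(1) K(3)] by (rule rev_subsetD)
qed

text \<open>The class of a uniform submodule reappears in a component that this submodule avoids.
  This bounds the number of classes of \<open>Q\<close> by the number of terms.\<close>

lemma As_subset_decomposition:
  assumes dec: "primary_decomposition R M N s C"
    and X: "\<And>i. i \<in> {1..s} \<Longrightarrow> As R (quot_module M (C i)) = {X i}"
  shows "As R Q \<subseteq> X ` {1..s}"
proof
  fix Y assume "Y \<in> As R Q"
  then obtain U where U: "submodule U R Q" "uniform_module R (Q\<lparr>carrier := U\<rparr>)"
    and Y: "Y = ess_class R (Q\<lparr>carrier := U\<rparr>)" by (auto simp: As_def)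
  obtain i where i: "i \<in> {1..s}" "U \<inter> proj ` C i = {\<zero>\<^bsub>Q\<^esub>}"
    using uniform_avoids_component[OF dec U] .
  have "Y \<in> As R (quot_module M (C i))"
    unfolding Y by (rule ess_class_in_component[OF U primary_decompositionD(1,2)[OF dec i(1)] i(2)])
  then show "Y \<in> X ` {1..s}" using X i(1) by auto
qed

end

section \<open>Merging components of equal class\<close>

text \<open>Decompositions are shortened as finite sets, where repeated terms collapse by
  themselves; an enumeration of the set then restores the indexing by
  \<open>{1..card F}\<close>.\<close>

lemma primary_decomposition_of_set:
  assumes "finite F" "F \<noteq> {}" "\<And>K. K \<in> F \<Longrightarrow> primary_submodule R M K" "\<Inter>F = N"
  obtains D where "primary_decomposition R M N (card F) D"
proof -
  obtain D where D: "bij_betw D {1..card F} F" using ex_bij_betw_nat_finite_1[OF assms(1)] by blast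
  then have im: "D ` {1..card F} = F" by (simp add: bij_betw_def)
  have "primary_decomposition R M N (card F) D"
    unfolding primary_decomposition_def
  proof (intro conjI ballI)
    show "1 \<le> card F" using assms(1,2) by (simp add: Suc_le_eq card_gt_0_iff)
    show "primary_submodule R M (D i)" if "i \<in> {1..card F}" for i using assms(3) im that by blast
    show "N = (\<Inter>i\<in>{1..card F}. D i)" using assms(4) im by simp
  qed
  then show ?thesis by (rule that)
qed

lemma shortest_le_card:
  assumes "shortest_primary_decomposition R M N s C"
    and "finite F" "F \<noteq> {}" "\<And>K. K \<in> F \<Longrightarrow> primary_submodule R M K" "\<Inter>F = N"
  shows "s \<le> card F"
proof -
  obtain D where "primary_decomposition R M N (card F) D"
    using primary_decomposition_of_set[OF assms(2-5)] .
  then show ?thesis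
    using assms(1) unfolding shortest_primary_decomposition_def by (blast intro: leI)
qed

locale uniformly_finite_quotient = left_module_quotient +
  assumes uf: "uniformly_finite R M"
begin

lemma quot_finite_uniform_dim: "finite_uniform_dim R Q"
  using uf N by (simp add: uniformly_finite_def)

lemma As_quot_nonempty:
  assumes "N \<noteq> carrier M"
  shows "As R Q \<noteq> {}"
proof -
  have "carrier Q \<noteq> {\<zero>\<^bsub>Q\<^esub>}" using assms quot_trivial_iff by simp
  then have "As R (Q\<lparr>carrier := carrier Q\<rparr>) \<noteq> {}"
    by (rule Q.As_nonempty[OF quot_finite_uniform_dim Q.submodule_carrier])
  then show ?thesis using Q.As_mono[OF Q.submodule_carrier] by blast
qed

text \<open>Every class of \<open>Q\<close> occurs in some component, so \<open>X\<close> is the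
  only candidate. A class does occur: a component with nonempty \<open>As\<close> is proper, so
  \<open>N\<close> is proper too, and the nonzero module \<open>Q\<close> of finite uniform
  dimension has a uniform submodule.\<close>

lemma primary_of_decomposition:
  assumes dec: "primary_decomposition R M N s C"
    and X: "\<And>i. i \<in> {1..s} \<Longrightarrow> As R (quot_module M (C i)) = {X}"
  shows "primary_submodule R M N"
proof -
  have 1: "1 \<in> {1..s}" using dec by (simp add: primary_decomposition_def)
  interpret C1: left_module_quotient R M "C 1"
    using left_module_axioms primary_decompositionD(1)[OF dec 1]
    by (simp add: left_module_quotient_def left_module_quotient_axioms_def)
  have "C 1 \<noteq> carrier M" using X[OF 1] by (intro C1.As_quot_nonempty_imp) simp
  then have "N \<noteq> carrier M"
    using primary_decompositionD(2)[OF dec 1] C1.N_subset by blast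
  moreover have "As R Q \<subseteq> {X}" using As_subset_decomposition[OF dec, of "\<lambda>_. X"] X by auto
  ultimately have "As R Q = {X}" using As_quot_nonempty by blast
  then show ?thesis using N quot_finite_uniform_dim by (auto simp: primary_submodule_def)
qed

end

context left_module
begin

lemma primary_Int:
  assumes uf: "uniformly_finite R M" and K: "primary_submodule R M K" "primary_submodule R M K'"
    and X: "As R (quot_module M K) = {X}" "As R (quot_module M K') = {X}"
  shows "primary_submodule R M (K \<inter> K')"
proof -
  have "submodule (K \<inter> K') R M" using K by (simp add: primary_submodule_def submodule_Int)
  then interpret uniformly_finite_quotient R M "K \<inter> K'"
    using left_module_axioms uf
    by (simp add: uniformly_finite_quotient_def uniformly_finite_quotient_axioms_def
        left_module_quotient_def left_module_quotient_axioms_def)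
  have "{1..2} = {1, 2::nat}" by auto
  then have "primary_decomposition R M (K \<inter> K') 2 (\<lambda>i. if i = 1 then K else K')"
    using K by (auto simp: primary_decomposition_def)
  then show ?thesis by (rule primary_of_decomposition[where X = X]) (simp add: X)
qed

text \<open>Two components of the same class could be replaced by their intersection, which is
  primary by \<open>primary_Int\<close>, leaving at most \<open>s - 1\<close> terms.\<close>

lemma shortest_inj_on:
  assumes uf: "uniformly_finite R M" and short: "shortest_primary_decomposition R M N s C"
    and X: "\<And>i. i \<in> {1..s} \<Longrightarrow> As R (quot_module M (C i)) = {X i}"
  shows "inj_on X {1..s}"
proof (rule inj_onI, rule ccontr)
  fix i j assume ij: "i \<in> {1..s}" "j \<in> {1..s}" "X i = X j" "i \<noteq> j"
  have prim: "primary_submodule R M (C k)" if "k \<in> {1..s}" for k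
    using short that by (simp add: shortest_primary_decomposition_def primary_decomposition_def)
  have N: "N = (\<Inter>i\<in>{1..s}. C i)"
    using short by (simp add: shortest_primary_decomposition_def primary_decomposition_def)
  let ?I = "{1..s} - {i, j}"
  let ?F = "insert (C i \<inter> C j) (C ` ?I)"
  have "s \<le> card ?F"
  proof (rule shortest_le_card[OF short])
    show "primary_submodule R M K" if "K \<in> ?F" for K
      using that prim primary_Int[OF uf prim[OF ij(1)] prim[OF ij(2)]] X ij by auto
    have "\<Inter>?F = (\<Inter>i\<in>insert i (insert j ?I). C i)" by auto
    also have "insert i (insert j ?I) = {1..s}" using ij by auto
    finally show "\<Inter>?F = N" using N by simp
  qed auto
  also have "card ?F \<le> Suc (card (C ` ?I))" by (rule card_insert_le_m1) auto
  also have "\<dots> \<le> Suc (card ?I)" using card_image_le[of ?I C] by simp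
  also have "card ?I = s - 2" using ij by (simp add: card_Diff_subset)
  \<comment> \<open>\<open>s \<le> Suc (s - 2)\<close> is impossible because two different indices
    in \<open>{1..s}\<close> force \<open>s \<ge> 2\<close>.\<close>
  finally show False using ij by (cases s; cases "s - 1") auto
qed

end

section \<open>From complements to a maximal shortest decomposition\<close>

text \<open>The data are bundled in a locale so that the converse direction can instantiate it with
  complements of its own and inherit the results proved here.\<close>

locale complement_family = uniformly_finite_quotient +
  fixes s :: nat and W X Cbar C
  assumes proper: "N \<noteq> carrier M"
    and W: "i \<in> {1..s} \<Longrightarrow> submodule (W i) R Q" "i \<in> {1..s} \<Longrightarrow> W i \<noteq> {\<zero>\<^bsub>Q\<^esub>}"
    and ess: "essential_submodule R Q (submodule_sum Q {1..s} W)"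
    and As_W: "i \<in> {1..s} \<Longrightarrow> As R (Q\<lparr>carrier := W i\<rparr>) = {X i}"
    and inj: "inj_on X {1..s}"
    and compl: "i \<in> {1..s} \<Longrightarrow> complement_to R Q (W i) (Cbar i)"
    and W_Cbar: "\<lbrakk>i \<in> {1..s}; j \<in> {1..s}; j \<noteq> i\<rbrakk> \<Longrightarrow> W j \<subseteq> Cbar i"
    and C: "i \<in> {1..s} \<Longrightarrow> C i = {m \<in> carrier M. proj m \<in> Cbar i}"
begin

lemma Cbar: "i \<in> {1..s} \<Longrightarrow> submodule (Cbar i) R Q" "i \<in> {1..s} \<Longrightarrow> W i \<inter> Cbar i = {\<zero>\<^bsub>Q\<^esub>}"
  using compl[of i] by (simp_all add: complement_to_def)

lemma submodule_C:
  assumes "i \<in> {1..s}"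
  shows "submodule (C i) R M" "N \<subseteq> C i" "proj ` C i = Cbar i"
  unfolding C[OF assms]
  by (rule submodule_vimage_proj[OF Cbar(1)[OF assms]] proj_image_vimage[OF Cbar(1)[OF assms]])+

lemma As_C:
  assumes "i \<in> {1..s}"
  shows "As R (quot_module M (C i)) = {X i}"
  using As_quot_eq[OF submodule_C(1,2)[OF assms] W(1)[OF assms]] compl[OF assms] As_W[OF assms]
    submodule_C(3)[OF assms] by simp

text \<open>Without summands the sum would be zero, which is not essential in the nonzero module
  \<open>Q\<close>.\<close>

lemma s_ge_1: "1 \<le> s"
proof (rule ccontr)
  assume "\<not> 1 \<le> s"
  then have "submodule_sum Q {1..s} W = {\<zero>\<^bsub>Q\<^esub>}" by (auto simp: submodule_sum_def)
  moreover have "carrier Q \<noteq> {\<zero>\<^bsub>Q\<^esub>}" using proper quot_trivial_iff by simp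
  ultimately show False using ess Q.submodule_carrier by (auto simp: essential_submodule_def)
qed

text \<open>Write \<open>x\<close> as the sum of the \<open>w i\<close>. All terms except the one at
  \<open>i\<close> lie in \<open>Cbar i\<close>, and so does \<open>x\<close>; hence
  \<open>w i\<close> lies in \<open>Cbar i\<close> as well as in \<open>W i\<close>, and is
  zero.\<close>

lemma sum_Int_Cbar:
  assumes x: "x \<in> submodule_sum Q {1..s} W" "\<And>i. i \<in> {1..s} \<Longrightarrow> x \<in> Cbar i"
  shows "x = \<zero>\<^bsub>Q\<^esub>"
proof -
  obtain w where w: "w \<in> Pi {1..s} W" "x = finsum Q w {1..s}"
    using x(1) by (auto simp: submodule_sum_def)
  have wc: "w \<in> {1..s} \<rightarrow> carrier Q"
    using w(1) submodule_subset[OF W(1)] by blast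
  have "w i = \<zero>\<^bsub>Q\<^esub>" if i: "i \<in> {1..s}" for i
  proof -
    let ?r = "finsum Q w ({1..s} - {i})"
    have r: "?r \<in> Cbar i"
      using w(1) W_Cbar[OF i] by (intro Q.finsum_submodule[OF Cbar(1)[OF i]]) blast
    then have rc: "?r \<in> carrier Q" using submodule_subset[OF Cbar(1)[OF i]] by auto
    have wi: "w i \<in> carrier Q" using wc i by auto
    have "x = w i \<oplus>\<^bsub>Q\<^esub> ?r" using w(2) Q.finsum_remove[OF _ i wc] by simp
    then have "w i = x \<oplus>\<^bsub>Q\<^esub> \<ominus>\<^bsub>Q\<^esub> ?r" using wi rc by (simp add: Q.M.a_assoc Q.M.r_neg)
    then have "w i \<in> Cbar i"
      using submodule_add[OF Cbar(1)[OF i] x(2)[OF i] submodule_a_inv[OF Cbar(1)[OF i] r]] by simp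
    then show ?thesis using Cbar(2)[OF i] w(1) i by blast
  qed
  then show ?thesis unfolding w(2) by (intro Q.M.add.finprod_one_eqI) simp
qed

lemma INT_Cbar: "carrier Q \<inter> (\<Inter>i\<in>{1..s}. Cbar i) = {\<zero>\<^bsub>Q\<^esub>}"
proof (rule ccontr)
  assume "carrier Q \<inter> (\<Inter>i\<in>{1..s}. Cbar i) \<noteq> {\<zero>\<^bsub>Q\<^esub>}"
  moreover have sub: "submodule (carrier Q \<inter> (\<Inter>i\<in>{1..s}. Cbar i)) R Q"
    by (rule Q.submodule_INT[OF Cbar(1)])
  ultimately have "submodule_sum Q {1..s} W \<inter> (carrier Q \<inter> (\<Inter>i\<in>{1..s}. Cbar i)) \<noteq> {\<zero>\<^bsub>Q\<^esub>}"
    using ess by (simp add: essential_submodule_def)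
  moreover have "\<zero>\<^bsub>Q\<^esub> \<in> submodule_sum Q {1..s} W"
    using ess submodule_zero by (auto simp: essential_submodule_def)
  ultimately show False using sum_Int_Cbar submodule_zero[OF sub] by blast
qed

lemma decomposition: "primary_decomposition R M N s C"
  unfolding primary_decomposition_def
proof (intro conjI ballI s_ge_1)
  show "primary_submodule R M (C i)" if "i \<in> {1..s}" for i
    using submodule_C(1)[OF that] As_C[OF that] uf
    by (auto simp: primary_submodule_def uniformly_finite_def)
  show "N = (\<Inter>i\<in>{1..s}. C i)"
  proof
    show "N \<subseteq> (\<Inter>i\<in>{1..s}. C i)" using submodule_C(2) by blast
    show "(\<Inter>i\<in>{1..s}. C i) \<subseteq> N"
    proof
      fix m assume m: "m \<in> (\<Inter>i\<in>{1..s}. C i)"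
      have "m \<in> C 1" using m s_ge_1 by auto
      then have mc: "m \<in> carrier M" using submodule_subset[OF submodule_C(1)[of 1]] s_ge_1 by auto
      have "proj m \<in> carrier Q \<inter> (\<Inter>i\<in>{1..s}. Cbar i)" using m mc C by (auto simp: quot_carrier)
      then have "proj m = N" unfolding INT_Cbar by (simp add: quot_zero)
      then show "m \<in> N" using mc proj_eq_N_iff by simp
    qed
  qed
qed

text \<open>The \<open>s\<close> pairwise different classes \<open>X i\<close> all belong to
  \<open>As R Q\<close>, while a decomposition with \<open>t\<close> terms leaves room for at most
  \<open>t\<close> classes.\<close>

lemma shortest: "shortest_primary_decomposition R M N s C"
  unfolding shortest_primary_decomposition_def
proof (intro conjI notI decomposition, elim exE conjE)
  fix t D assume t: "t < s" and dec: "primary_decomposition R M N t D"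
  then obtain Y where Y: "\<And>i. i \<in> {1..t} \<Longrightarrow> As R (quot_module M (D i)) = {Y i}"
    unfolding primary_decomposition_def primary_submodule_def by metis
  have "X ` {1..s} \<subseteq> As R Q"
    using As_W Q.As_mono[OF W(1)] by fastforce
  also have "\<dots> \<subseteq> Y ` {1..t}" by (rule As_subset_decomposition[OF dec Y])
  finally have "card (X ` {1..s}) \<le> card (Y ` {1..t})" by (intro card_mono) auto
  also have "\<dots> \<le> t" using card_image_le[of "{1..t}" Y] by simp
  finally show False using t card_image[OF inj] by simp
qed

lemma maximal: "maximal_shortest_primary_decomposition R M N s C"
  unfolding maximal_shortest_primary_decomposition_def
proof (intro conjI shortest allI impI ballI)
  fix C' i
  assume C': "shortest_primary_decomposition R M N s C' \<and>
    (\<forall>i\<in>{1..s}. As R (quot_module M (C' i)) = As R (quot_module M (C i)) \<and> C i \<subseteq> C' i)"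
    and i: "i \<in> {1..s}"
  have dec: "primary_decomposition R M N s C'"
    using C' by (simp add: shortest_primary_decomposition_def)
  note D = primary_decompositionD[OF dec]
  \<comment> \<open>A nonzero intersection would contain a uniform \<open>U\<close> of class
    \<open>X i\<close>. Some component \<open>C' j\<close> is avoided by \<open>U\<close>, and
    comparing classes gives \<open>j = i\<close>, although \<open>U\<close> lies in the image of
    \<open>C' i\<close>.\<close>
  have "W i \<inter> proj ` C' i = {\<zero>\<^bsub>Q\<^esub>}"
  proof (rule ccontr)
    assume ne: "W i \<inter> proj ` C' i \<noteq> {\<zero>\<^bsub>Q\<^esub>}"
    obtain U where U: "submodule U R Q" "U \<subseteq> W i \<inter> proj ` C' i" "uniform_module R (Q\<lparr>carrier := U\<rparr>)"
      using Q.exists_uniform[OF quot_finite_uniform_dim Q.submodule_Int[OF W(1)[OF i] D(3)[OF i]] ne] .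
    have cls: "ess_class R (Q\<lparr>carrier := U\<rparr>) = X i"
      using As_W[OF i] U by (auto simp: Q.As_restrict[OF W(1)[OF i]])
    obtain j where j: "j \<in> {1..s}" "U \<inter> proj ` C' j = {\<zero>\<^bsub>Q\<^esub>}"
      using uniform_avoids_component[OF dec U(1,3)] .
    then have "X i \<in> As R (quot_module M (C' j))"
      using ess_class_in_component[OF U(1,3) D(1,2)[OF j(1)] j(2)] cls by simp
    then have "X i = X j" using C' As_C j(1) by simp
    then have "i = j" using inj i j(1) by (simp add: inj_on_eq_iff)
    then have "U = {\<zero>\<^bsub>Q\<^esub>}" using j(2) U(2) by auto
    then show False using Q.uniform_nonzero[OF U(1,3)] by simp
  qed
  moreover have "Cbar i \<subseteq> proj ` C' i"
    using C' i submodule_C(3)[OF i] by (metis image_mono)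
  ultimately have "proj ` C' i = Cbar i"
    using compl[OF i] D(3)[OF i] by (simp add: complement_to_def)
  then have eq: "proj ` C' i = proj ` C i" using submodule_C(3)[OF i] by simp
  \<comment> \<open>Both components contain \<open>N\<close>, so equality of their images in
    \<open>Q\<close> lifts to \<open>M\<close>.\<close>
  have "C i = {m \<in> carrier M. proj m \<in> proj ` C i}"
    by (rule vimage_proj_image[OF submodule_C(1,2)[OF i], symmetric])
  also have "\<dots> = {m \<in> carrier M. proj m \<in> proj ` C' i}" by (simp only: eq)
  also have "\<dots> = C' i" by (rule vimage_proj_image[OF D(1,2)[OF i]])
  finally show "C i = C' i" .
qed

end


section \<open>From a maximal shortest decomposition to complements\<close>

lemma (in uniformly_finite_quotient) maximal_imp_complement_family:
  assumes proper: "N \<noteq> carrier M" and max: "maximal_shortest_primary_decomposition R M N s C"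
  obtains W X Cbar where "complement_family R M N s W X Cbar C" "direct_family Q {1..s} W"
proof -
  have short: "shortest_primary_decomposition R M N s C"
    using max by (simp add: maximal_shortest_primary_decomposition_def)
  then have dec: "primary_decomposition R M N s C"
    by (simp add: shortest_primary_decomposition_def)
  then obtain X where X: "\<And>i. i \<in> {1..s} \<Longrightarrow> As R (quot_module M (C i)) = {X i}"
    unfolding primary_decomposition_def primary_submodule_def by metis
  have prim: "primary_submodule R M (C k)" if "k \<in> {1..s}" for k
    using dec that by (simp add: primary_decomposition_def)
  note D = primary_decompositionD[OF dec]
  have inj: "inj_on X {1..s}" by (rule shortest_inj_on[OF uf short X])
  \<comment> \<open>By construction \<open>W i\<close> lies in the image of every component except
    possibly \<open>C i\<close>, and it meets that one only in zero. For \<open>s = 1\<close> it is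
    all of \<open>Q\<close>.\<close>
  define W where "W i = carrier Q \<inter> (\<Inter>j\<in>{1..s} - {i}. proj ` C j)" for i
  have subW: "submodule (W i) R Q" for i
    unfolding W_def by (rule Q.submodule_INT) (use D(3) in auto)
  have W_sub: "W j \<subseteq> proj ` C i" if "i \<in> {1..s}" "j \<noteq> i" for i j
    using that by (auto simp: W_def)
  have W_Int: "W i \<inter> proj ` C i = {\<zero>\<^bsub>Q\<^esub>}" if i: "i \<in> {1..s}" for i
  proof
    show "W i \<inter> proj ` C i \<subseteq> {\<zero>\<^bsub>Q\<^esub>}"
    proof
      fix x assume x: "x \<in> W i \<inter> proj ` C i"
      have "x \<in> proj ` C j" if "j \<in> {1..s}" for j
        using x W_sub[OF that, of i] by (cases "j = i") auto
      moreover have "x \<in> carrier Q" using x by (simp add: W_def)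
      ultimately have "x = \<zero>\<^bsub>Q\<^esub>" using INT_proj_image[OF dec] by blast
      then show "x \<in> {\<zero>\<^bsub>Q\<^esub>}" by simp
    qed
    show "{\<zero>\<^bsub>Q\<^esub>} \<subseteq> W i \<inter> proj ` C i"
      using submodule_zero[OF subW] submodule_zero[OF D(3)[OF i]] by blast
  qed
  \<comment> \<open>If \<open>W i\<close> were zero, the component \<open>C i\<close> could be
    dropped. Dropping is only possible when another component is left; for \<open>s = 1\<close>
    instead, \<open>W i = carrier Q\<close> is nonzero because \<open>N\<close> is proper.\<close>
  have W_ne: "W i \<noteq> {\<zero>\<^bsub>Q\<^esub>}" if i: "i \<in> {1..s}" for i
  proof
    assume W0: "W i = {\<zero>\<^bsub>Q\<^esub>}"
    have ne: "{1..s} - {i} \<noteq> {}"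
    proof
      assume "{1..s} - {i} = {}"
      then have "W i = carrier Q" by (simp only: W_def) simp
      then show False using W0 quot_trivial_iff proper by simp
    qed
    have "s \<le> card (C ` ({1..s} - {i}))"
    proof (rule shortest_le_card[OF short])
      show "\<Inter>(C ` ({1..s} - {i})) = N"
      proof
        show "N \<subseteq> \<Inter>(C ` ({1..s} - {i}))" using D(2) by blast
        show "\<Inter>(C ` ({1..s} - {i})) \<subseteq> N"
        proof
          fix m assume m: "m \<in> \<Inter>(C ` ({1..s} - {i}))"
          obtain j where j: "j \<in> {1..s} - {i}" using ne by blast
          then have "m \<in> carrier M" using m submodule_subset[OF D(1)[of j]] by auto
          then have "proj m \<in> W i" using m by (auto simp: W_def quot_carrier)
          then show "m \<in> N" using W0 \<open>m \<in> carrier M\<close> proj_eq_N_iff by (simp add: quot_zero)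
        qed
      qed
    qed (use ne prim in auto)
    also have "\<dots> \<le> card ({1..s} - {i})" by (rule card_image_le) simp
    also have "\<dots> = s - 1" using i by simp
    finally show False using i by auto
  qed
  \<comment> \<open>\<open>W i\<close> embeds in \<open>M/C\<^sub>i\<close>, so \<open>X i\<close>
    is its only possible class, and finite uniform dimension provides at least one class.\<close>
  have As_W: "As R (Q\<lparr>carrier := W i\<rparr>) = {X i}" if i: "i \<in> {1..s}" for i
    using As_subset_quot[OF D(1,2)[OF i] subW W_Int[OF i]] X[OF i]
      Q.As_nonempty[OF quot_finite_uniform_dim subW W_ne[OF i]] by auto
  have direct: "direct_family Q {1..s} W"
    unfolding direct_family_def
  proof (intro allI impI ballI)
    fix J x j
    assume "J \<subseteq> {1..s} \<and> finite J \<and> x \<in> Pi J W \<and> finsum Q x J = \<zero>\<^bsub>Q\<^esub>" and j: "j \<in> J"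
    then have J: "J \<subseteq> {1..s}" "finite J" "x \<in> Pi J W" "finsum Q x J = \<zero>\<^bsub>Q\<^esub>" by simp_all
    have js: "j \<in> {1..s}" using J(1) j by auto
    have xc: "x \<in> J \<rightarrow> carrier Q" using J(3) by (auto simp: W_def Pi_iff)
    \<comment> \<open>All summands other than \<open>x j\<close> lie in the image of
      \<open>C j\<close>; since the total is zero, so does \<open>x j\<close>, which is then zero by
      \<open>W_Int\<close>.\<close>
    have "finsum Q x (J - {j}) \<in> proj ` C j"
      using J(3) W_sub[OF js] by (intro Q.finsum_submodule[OF D(3)[OF js]]) (auto simp: Pi_iff)
    moreover have "x j \<oplus>\<^bsub>Q\<^esub> finsum Q x (J - {j}) = \<zero>\<^bsub>Q\<^esub>"
      using Q.finsum_remove[OF J(2) j xc] J(4) by simp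
    ultimately have "x j \<in> proj ` C j"
      using Q.submodule_add_eq_zero[OF D(3)[OF js]] xc j by blast
    then show "x j = \<zero>\<^bsub>Q\<^esub>" using W_Int[OF js] J(3) j by auto
  qed
  let ?S = "submodule_sum Q {1..s} W"
  have S: "submodule ?S R Q" by (rule Q.submodule_submodule_sum[OF subW])
  have ess: "essential_submodule R Q ?S"
    unfolding essential_submodule_def
  proof (intro conjI S allI impI notI, elim conjE)
    fix L assume L: "submodule L R Q" "L \<noteq> {\<zero>\<^bsub>Q\<^esub>}" and SL: "?S \<inter> L = {\<zero>\<^bsub>Q\<^esub>}"
    \<comment> \<open>\<open>U\<close> avoids the image of some \<open>C i\<close>. As the classes
      are distinct, it meets the images of all other components, hence also their intersection
      \<open>W i\<close>, which is contained in the sum.\<close>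
    obtain U where U: "submodule U R Q" "U \<subseteq> L" "uniform_module R (Q\<lparr>carrier := U\<rparr>)"
      using Q.exists_uniform[OF quot_finite_uniform_dim L] .
    have cls: "ess_class R (Q\<lparr>carrier := U\<rparr>) = X i"
      if "i \<in> {1..s}" "U \<inter> proj ` C i = {\<zero>\<^bsub>Q\<^esub>}" for i
      using ess_class_in_component[OF U(1,3) D(1,2)[OF that(1)] that(2)] X[OF that(1)] by simp
    obtain i where i: "i \<in> {1..s}" "U \<inter> proj ` C i = {\<zero>\<^bsub>Q\<^esub>}"
      using uniform_avoids_component[OF dec U(1,3)] .
    have "U \<inter> proj ` C j \<noteq> {\<zero>\<^bsub>Q\<^esub>}" if "j \<in> {1..s} - {i}" for j
      using that cls[OF i] cls[of j] i(1) inj by (auto simp: inj_on_eq_iff)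
    then have "U \<inter> (\<Inter>j\<in>{1..s} - {i}. proj ` C j) \<noteq> {\<zero>\<^bsub>Q\<^esub>}"
      using D(3) by (intro Q.uniform_Int_INT[OF U(1,3)]) auto
    moreover have "U \<inter> (\<Inter>j\<in>{1..s} - {i}. proj ` C j) = U \<inter> W i"
      using submodule_subset[OF U(1)] by (auto simp: W_def)
    moreover have "U \<inter> W i \<subseteq> ?S \<inter> L"
      using U(2) Q.submodule_sum_upper[OF _ i(1), of W] subW by auto
    moreover have "\<zero>\<^bsub>Q\<^esub> \<in> U \<inter> W i" using submodule_zero[OF U(1)] submodule_zero[OF subW] by blast
    ultimately show False using SL by auto
  qed
  \<comment> \<open>The image of \<open>C i\<close> misses \<open>W i\<close> and contains the other
    \<open>W j\<close>. It is enlarged to a complement of \<open>W i\<close>, which still contains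
    them.\<close>
  have "\<forall>i\<in>{1..s}. \<exists>B. proj ` C i \<subseteq> B \<and> complement_to R Q (W i) B"
  proof
    fix i assume i: "i \<in> {1..s}"
    obtain B where "proj ` C i \<subseteq> B" "complement_to R Q (W i) B"
      using Q.complement_exists[OF subW D(3)[OF i] W_Int[OF i]] .
    then show "\<exists>B. proj ` C i \<subseteq> B \<and> complement_to R Q (W i) B" by blast
  qed
  from bchoice[OF this] obtain B
    where "\<forall>i\<in>{1..s}. proj ` C i \<subseteq> B i \<and> complement_to R Q (W i) (B i)" ..
  then have B: "proj ` C i \<subseteq> B i" "complement_to R Q (W i) (B i)" if "i \<in> {1..s}" for i
    using that by simp_all
  have W_B: "W j \<subseteq> B i" if "i \<in> {1..s}" "j \<in> {1..s}" "j \<noteq> i" for i j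
    using W_sub[OF that(1,3)] B(1)[OF that(1)] by (rule order_trans)
  \<comment> \<open>The family of preimages is left open as \<open>E\<close> because it is used
    twice: for the enlarged components \<open>C'\<close>, and for \<open>C\<close> itself once
    maximality has identified the two.\<close>
  have family: "complement_family R M N s W X B E"
    if "\<And>i. i \<in> {1..s} \<Longrightarrow> E i = {m \<in> carrier M. proj m \<in> B i}" for E
    by (intro complement_family.intro complement_family_axioms.intro uniformly_finite_quotient_axioms)
      (simp_all only: proper subW W_ne ess As_W inj B(2) W_B that simp_thms)
  define C' where "C' i = {m \<in> carrier M. proj m \<in> B i}" for i
  interpret F: complement_family R M N s W X B C'
    by (rule family) (simp add: C'_def)
  have "C i \<subseteq> C' i" if "i \<in> {1..s}" for i
    using B(1)[OF that] submodule_subset[OF D(1)[OF that]] by (auto simp: C'_def)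
  \<comment> \<open>The enlarged component has class \<open>X i\<close> by \<open>F.As_C\<close>,
    just like \<open>C i\<close>, so \<open>C'\<close> is a competitor to which the maximality of
    \<open>C\<close> applies.\<close>
  then have "\<forall>i\<in>{1..s}. As R (quot_module M (C' i)) = As R (quot_module M (C i)) \<and> C i \<subseteq> C' i"
    using F.As_C X by simp
  with F.shortest have "\<forall>i\<in>{1..s}. C i = C' i"
    using max[unfolded maximal_shortest_primary_decomposition_def, THEN conjunct2, rule_format, of C']
    by blast
  then have "complement_family R M N s W X B C"
    by (intro family) (simp add: C'_def)
  then show ?thesis using direct by (rule that)
qed

theorem corollary5p4:
  fixes R :: "('r, 'x) ring_scheme" and M :: "('r, 'b, 'y) module_scheme"
    and N :: "'b set" and s :: nat and C :: "nat \<Rightarrow> 'b set"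
  assumes "left_module R M"
    and "carrier M \<noteq> {\<zero>\<^bsub>M\<^esub>}"
    and "uniformly_finite R M"
    and "submodule N R M"
    and "N \<noteq> carrier M"
  shows "maximal_shortest_primary_decomposition R M N s C \<longleftrightarrow>
    (\<exists>W X Cbar.
      (\<forall>i\<in>{1..s}. submodule (W i) R (quot_module M N) \<and> W i \<noteq> {\<zero>\<^bsub>quot_module M N\<^esub>}) \<and>
      direct_family (quot_module M N) {1..s} W \<and>
      essential_submodule R (quot_module M N) (submodule_sum (quot_module M N) {1..s} W) \<and>
      (\<forall>i\<in>{1..s}. As R ((quot_module M N)\<lparr>carrier := W i\<rparr>) = {X i}) \<and>
      inj_on X {1..s} \<and>
      (\<forall>i\<in>{1..s}. complement_to R (quot_module M N) (W i) (Cbar i) \<and>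
         (\<forall>j\<in>{1..s}. j \<noteq> i \<longrightarrow> W j \<subseteq> Cbar i)) \<and>
      (\<forall>i\<in>{1..s}. C i = {m \<in> carrier M. N +>\<^bsub>M\<^esub> m \<in> Cbar i}))"
    (is "?L \<longleftrightarrow> ?R")
proof
  interpret uniformly_finite_quotient R M N
    using assms by (simp add: uniformly_finite_quotient_def uniformly_finite_quotient_axioms_def
        left_module_quotient_def left_module_quotient_axioms_def)
  show ?R if l: ?L
  proof -
    obtain W X Cbar where fam: "complement_family R M N s W X Cbar C"
      and direct: "direct_family (quot_module M N) {1..s} W"
      using maximal_imp_complement_family[OF assms(5) l] .
    interpret complement_family R M N s W X Cbar C by (rule fam)
    show ?R
      by (rule exI[of _ W], rule exI[of _ X], rule exI[of _ Cbar], intro conjI ballI impI)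
        (simp_all only: W direct ess As_W inj compl W_Cbar C simp_thms)
  qed
  show ?L if r: ?R
  proof -
    from r obtain W X Cbar where fam:
      "\<forall>i\<in>{1..s}. submodule (W i) R (quot_module M N) \<and> W i \<noteq> {\<zero>\<^bsub>quot_module M N\<^esub>}"
      "essential_submodule R (quot_module M N) (submodule_sum (quot_module M N) {1..s} W)"
      "\<forall>i\<in>{1..s}. As R ((quot_module M N)\<lparr>carrier := W i\<rparr>) = {X i}"
      "inj_on X {1..s}"
      "\<forall>i\<in>{1..s}. complement_to R (quot_module M N) (W i) (Cbar i) \<and>
         (\<forall>j\<in>{1..s}. j \<noteq> i \<longrightarrow> W j \<subseteq> Cbar i)"
      "\<forall>i\<in>{1..s}. C i = {m \<in> carrier M. N +>\<^bsub>M\<^esub> m \<in> Cbar i}"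
      by (elim exE conjE) (rule that, assumption+)
    have "complement_family R M N s W X Cbar C"
      by (intro complement_family.intro complement_family_axioms.intro
          uniformly_finite_quotient_axioms assms(5))
        (simp_all only: fam simp_thms)
    then show ?L by (rule complement_family.maximal)
  qed
qed

end
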